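(* The partial order of Hyp subsets of $\omega$ under inclusion can be order-preservingly embedded into the structure of Hyp-degrees of Hyp equivalence relations between $=_1$ and $=_2$; that is, there is an assignment $X\mapsto E_X$ of a Hyp equivalence relation $E_X$ on $\mathscr N$ to each Hyp set $X\subseteq\omega$ such that $=_1\leq_H E_X\leq_H\ =_2$ for all $X$, and for all Hyp $X,Y\subseteq\omega$, $X\subseteq Y\iff E_X\leq_H E_Y$.
   Context: $\mathscr N=\omega^\omega$. Hyp means lightface $\Delta^1_1$ (functions via their graphs). For equivalence relations $E,F$ on $\mathscr N$, $E\leq_H F$ means there is a Hyp function $f:\mathscr N\to\mathscr N$ with $xEy\iff f(x)Ff(y)$; the Hyp-degree of $E$ is its class under $E\equiv_H F\iff(E\leq_H F\wedge F\leq_H E)$. $=_1$ is the equivalence relation on $\mathscr N$ with a single class; $=_2$ is given by $x\equiv y$ iff $x(0)=y(0)$ or both $x(0),y(0)\geq1$. *)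

theory Defs
  imports Main
begin

type_synonym baire = "nat \<Rightarrow> nat"

section \<open>The lightface class \<open>\<Delta>\<^sup>1\<^sub>1\<close>\<close>

text \<open>
  Terms and arithmetical formulas of second-order arithmetic, with second-order variables ranging
  over functions in \<open>\<omega>\<^sup>\<omega>\<close>. \<open>App i t\<close> applies the \<open>i\<close>-th function variable to \<open>t\<close>. Only number
  quantifiers occur in \<open>afm\<close>; number variables are de Bruijn indices.
\<close>

datatype atm = NVar nat | Zero | Succ atm | Plus atm atm | Times atm atm | App nat atm

datatype afm = Eq atm atm | Neg afm | Conj afm afm | All afm

primrec tval :: "(nat \<Rightarrow> nat) \<Rightarrow> (nat \<Rightarrow> baire) \<Rightarrow> atm \<Rightarrow> nat" where
  "tval e F (NVar i) = e i"
| "tval e F Zero = 0"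
| "tval e F (Succ t) = Suc (tval e F t)"
| "tval e F (Plus s t) = tval e F s + tval e F t"
| "tval e F (Times s t) = tval e F s * tval e F t"
| "tval e F (App i t) = F i (tval e F t)"

primrec asat :: "(nat \<Rightarrow> nat) \<Rightarrow> (nat \<Rightarrow> baire) \<Rightarrow> afm \<Rightarrow> bool" where
  "asat e F (Eq s t) \<longleftrightarrow> tval e F s = tval e F t"
| "asat e F (Neg p) \<longleftrightarrow> \<not> asat e F p"
| "asat e F (Conj p q) \<longleftrightarrow> asat e F p \<and> asat e F q"
| "asat e F (All p) \<longleftrightarrow> (\<forall>n. asat (case_nat n e) F p)"

text \<open>
  No parameters are allowed in lightface definitions: variables beyond the arguments are interpreted
  by \<open>0\<close>, respectively the constant function \<open>0\<close>.
\<close>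

definition nenv :: "nat list \<Rightarrow> nat \<Rightarrow> nat" where
  "nenv ns i = (if i < length ns then ns ! i else 0)"

definition fenv :: "baire list \<Rightarrow> nat \<Rightarrow> baire" where
  "fenv xs i = (if i < length xs then xs ! i else (\<lambda>_. 0))"

text \<open>
  \<open>Sigma11 k l P\<close>: the relation \<open>P \<subseteq> \<omega>\<^sup>k \<times> (\<omega>\<^sup>\<omega>)\<^sup>l\<close> is defined by a formula \<open>\<exists>y. \<phi>\<close> with \<open>\<phi>\<close>
  arithmetical and \<open>y\<close> ranging over \<open>\<omega>\<^sup>\<omega>\<close>. The witness \<open>y\<close> is the function variable \<open>0\<close>; the function
  arguments are the variables \<open>1, \<dots>, l\<close>. Only the values of \<open>P\<close> at lists of lengths \<open>k\<close> and \<open>l\<close>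
  matter.
\<close>

definition Sigma11 :: "nat \<Rightarrow> nat \<Rightarrow> (nat list \<Rightarrow> baire list \<Rightarrow> bool) \<Rightarrow> bool" where
  "Sigma11 k l P \<longleftrightarrow>
     (\<exists>\<phi>. \<forall>ns xs. length ns = k \<longrightarrow> length xs = l \<longrightarrow>
        (P ns xs \<longleftrightarrow> (\<exists>y. asat (nenv ns) (fenv (y # xs)) \<phi>)))"

definition Pi11 :: "nat \<Rightarrow> nat \<Rightarrow> (nat list \<Rightarrow> baire list \<Rightarrow> bool) \<Rightarrow> bool" where
  "Pi11 k l P \<longleftrightarrow> Sigma11 k l (\<lambda>ns xs. \<not> P ns xs)"

definition Delta11 :: "nat \<Rightarrow> nat \<Rightarrow> (nat list \<Rightarrow> baire list \<Rightarrow> bool) \<Rightarrow> bool" where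
  "Delta11 k l P \<longleftrightarrow> Sigma11 k l P \<and> Pi11 k l P"

definition Hyp_nat_set :: "nat set \<Rightarrow> bool" where
  "Hyp_nat_set X \<longleftrightarrow> Delta11 1 0 (\<lambda>ns xs. ns ! 0 \<in> X)"

definition Hyp_rel :: "(baire \<times> baire) set \<Rightarrow> bool" where
  "Hyp_rel R \<longleftrightarrow> Delta11 0 2 (\<lambda>ns xs. (xs ! 0, xs ! 1) \<in> R)"

definition Hyp_fun :: "(baire \<Rightarrow> baire) \<Rightarrow> bool" where
  "Hyp_fun f \<longleftrightarrow> Hyp_rel {(x, y). f x = y}"

section \<open>Hyp reducibility of equivalence relations on \<open>\<omega>\<^sup>\<omega>\<close>\<close>

definition Hyp_equiv :: "(baire \<times> baire) set \<Rightarrow> bool" where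
  "Hyp_equiv E \<longleftrightarrow> equiv UNIV E \<and> Hyp_rel E"

definition Hyp_le :: "(baire \<times> baire) set \<Rightarrow> (baire \<times> baire) set \<Rightarrow> bool" (infix "\<le>\<^sub>H" 50) where
  "E \<le>\<^sub>H F \<longleftrightarrow> (\<exists>f. Hyp_fun f \<and> (\<forall>x y. (x, y) \<in> E \<longleftrightarrow> (f x, f y) \<in> F))"

definition eq1 :: "(baire \<times> baire) set" where
  "eq1 = UNIV"

definition eq2 :: "(baire \<times> baire) set" where
  "eq2 = {(x, y). x 0 = y 0 \<or> (x 0 \<ge> 1 \<and> y 0 \<ge> 1)}"

end

theory Submission
  imports Defs "HOL-Library.Nat_Bijection" "HOL-Number_Theory.Cong"
begin

text \<open>
  Take \<open>E\<^sub>X\<close> with the two classes \<open>\<Oplus>\<^bsub>n \<in> X\<^esub> A\<^sub>n\<close> and its complement, where the uniformly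
  hyperarithmetical sets \<open>A\<^sub>n\<close> have no hyperarithmetical member and no hyperarithmetical function maps
  some \<open>A\<^sub>n\<close> into \<open>\<Oplus>\<^bsub>m \<noteq> n\<^esub> A\<^sub>m\<close>. Such a family exists by a diagonal argument. Suppose that every
  sequence \<open>A\<^sup>s\<close> of arithmetical sets, with index \<open>s\<close>, fails: it admits a hyperarithmetical function
  from some \<open>A\<^sup>s\<^sub>n\<close>, or from the whole space, into the sum of the other sets. That a given index \<open>v\<close> is
  one of such a function is a \<open>\<Pi>\<^sup>1\<^sub>1\<close> condition on \<open>s\<close> and \<open>v\<close>, so \<open>\<Pi>\<^sup>1\<^sub>1\<close> uniformization of relations with
  number values yields a \<open>\<Delta>\<^sup>1\<^sub>1\<close> selector \<open>s \<mapsto> v\<close>. Let \<open>s\<close> be the sequence whose \<open>n\<close>-th set consists of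
  the witnesses, in a \<open>\<Sigma>\<^sup>1\<^sub>1\<close> definition of the selector, that at \<open>s\<close> itself it selects a function
  defined on the \<open>n\<close>-th set. Then the domain of the selected function is nonempty while all other
  sets are empty, which is absurd.
\<close>

section \<open>Arithmetical relations and functions\<close>

type_synonym num_env = "nat \<Rightarrow> nat"
type_synonym fun_env = "nat \<Rightarrow> baire"

definition arith :: "(num_env \<Rightarrow> fun_env \<Rightarrow> bool) \<Rightarrow> bool" where
  "arith P \<longleftrightarrow> (\<exists>\<phi>. \<forall>e F. P e F \<longleftrightarrow> asat e F \<phi>)"

text \<open>The value sits in number variable 0, the slot that a quantifier binds, so composing
  functions amounts to quantifying over the inner value.\<close>

definition afun :: "(num_env \<Rightarrow> fun_env \<Rightarrow> nat) \<Rightarrow> bool" where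
  "afun f \<longleftrightarrow> arith (\<lambda>e F. e 0 = f (\<lambda>i. e (Suc i)) F)"

abbreviation areal :: "(num_env \<Rightarrow> fun_env \<Rightarrow> baire) \<Rightarrow> bool" where
  "areal G \<equiv> afun (\<lambda>e F. G (\<lambda>i. e (Suc i)) F (e 0))"

section \<open>Renaming of variables and closure under the logical operations\<close>

lemma tval_rename:
  "\<exists>t'. \<forall>e F. tval e F t' = tval (\<lambda>i. e (r i)) (\<lambda>i. F (q i)) t"
proof (induction t)
  case (NVar i)
  show ?case by (rule exI[of _ "NVar (r i)"]) simp
next
  case Zero
  show ?case by (rule exI[of _ Zero]) simp
next
  case (Succ t)
  then obtain t' where "\<forall>e F. tval e F t' = tval (\<lambda>i. e (r i)) (\<lambda>i. F (q i)) t" by blast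
  then show ?case by (intro exI[of _ "Succ t'"]) simp
next
  case (Plus s t)
  then obtain s' t' where "\<forall>e F. tval e F s' = tval (\<lambda>i. e (r i)) (\<lambda>i. F (q i)) s"
    "\<forall>e F. tval e F t' = tval (\<lambda>i. e (r i)) (\<lambda>i. F (q i)) t" by blast
  then show ?case by (intro exI[of _ "Plus s' t'"]) simp
next
  case (Times s t)
  then obtain s' t' where "\<forall>e F. tval e F s' = tval (\<lambda>i. e (r i)) (\<lambda>i. F (q i)) s"
    "\<forall>e F. tval e F t' = tval (\<lambda>i. e (r i)) (\<lambda>i. F (q i)) t" by blast
  then show ?case by (intro exI[of _ "Times s' t'"]) simp
next
  case (App i t)
  then obtain t' where "\<forall>e F. tval e F t' = tval (\<lambda>i. e (r i)) (\<lambda>i. F (q i)) t" by blast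
  then show ?case by (intro exI[of _ "App (q i) t'"]) simp
qed

lemma asat_rename:
  "\<exists>\<phi>'. \<forall>e F. asat e F \<phi>' = asat (\<lambda>i. e (r i)) (\<lambda>i. F (q i)) \<phi>"
proof (induction \<phi> arbitrary: r)
  case (Eq s t)
  obtain s' t' where "\<forall>e F. tval e F s' = tval (\<lambda>i. e (r i)) (\<lambda>i. F (q i)) s"
    "\<forall>e F. tval e F t' = tval (\<lambda>i. e (r i)) (\<lambda>i. F (q i)) t" using tval_rename by metis
  then show ?case by (intro exI[of _ "Eq s' t'"]) simp
next
  case (Neg p)
  then obtain p' where "\<forall>e F. asat e F p' = asat (\<lambda>i. e (r i)) (\<lambda>i. F (q i)) p" by blast
  then show ?case by (intro exI[of _ "Neg p'"]) simp
next
  case (Conj p1 p2)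
  from Conj.IH(1)[of r] Conj.IH(2)[of r] obtain p1' p2'
    where "\<forall>e F. asat e F p1' = asat (\<lambda>i. e (r i)) (\<lambda>i. F (q i)) p1"
    "\<forall>e F. asat e F p2' = asat (\<lambda>i. e (r i)) (\<lambda>i. F (q i)) p2" by blast
  then show ?case by (intro exI[of _ "Conj p1' p2'"]) simp
next
  case (All p)
  \<comment> \<open>Under a quantifier the renaming fixes the bound variable 0 and acts shifted on
    all others.\<close>
  let ?r = "case_nat 0 (\<lambda>i. Suc (r i))"
  obtain p' where p': "\<forall>e F. asat e F p' = asat (\<lambda>i. e (?r i)) (\<lambda>i. F (q i)) p"
    using All.IH[of ?r] by blast
  have "(\<lambda>i. case_nat n e (?r i)) = case_nat n (\<lambda>i. e (r i))" for n and e :: num_env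
    by (auto split: nat.split)
  with p' show ?case by (intro exI[of _ "All p'"]) simp
qed

lemma arith_rename: "arith P \<Longrightarrow> arith (\<lambda>e F. P (\<lambda>i. e (r i)) (\<lambda>i. F (q i)))"
  unfolding arith_def using asat_rename by metis

lemma arith_not: "arith P \<Longrightarrow> arith (\<lambda>e F. \<not> P e F)"
  unfolding arith_def by (metis asat.simps(2))

lemma arith_conj: "arith P \<Longrightarrow> arith Q \<Longrightarrow> arith (\<lambda>e F. P e F \<and> Q e F)"
  unfolding arith_def by (metis asat.simps(3))

lemma arith_disj: "arith P \<Longrightarrow> arith Q \<Longrightarrow> arith (\<lambda>e F. P e F \<or> Q e F)"
  using arith_not[OF arith_conj[OF arith_not[of P] arith_not[of Q]]] by simp

lemma arith_imp: "arith P \<Longrightarrow> arith Q \<Longrightarrow> arith (\<lambda>e F. P e F \<longrightarrow> Q e F)"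
  unfolding imp_conv_disj by (intro arith_disj arith_not)

text \<open>\<open>P\<close> receives the bound number as a separate argument. The de Bruijn shift
  is thus confined to the hypothesis, and the rule applies to ordinary quantified
  statements.\<close>

lemma arith_all:
  assumes "arith (\<lambda>e F. P (\<lambda>i. e (Suc i)) F (e 0))"
  shows "arith (\<lambda>e F. \<forall>n. P e F n)"
proof -
  obtain \<phi> where "\<forall>e F. P (\<lambda>i. e (Suc i)) F (e 0) \<longleftrightarrow> asat e F \<phi>"
    using assms unfolding arith_def by blast
  then have "asat (case_nat n e) F \<phi> \<longleftrightarrow> P (\<lambda>i. case_nat n e (Suc i)) F (case_nat n e 0)" for e F n
    by blast
  then have "asat (case_nat n e) F \<phi> \<longleftrightarrow> P e F n" for e F n
    by simp
  then show ?thesis unfolding arith_def by (intro exI[of _ "All \<phi>"]) simp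
qed

lemma arith_ex:
  assumes "arith (\<lambda>e F. P (\<lambda>i. e (Suc i)) F (e 0))"
  shows "arith (\<lambda>e F. \<exists>n. P e F n)"
  using arith_not[OF arith_all[of "\<lambda>e F n. \<not> P e F n"], OF arith_not, OF assms] by simp

lemma arith_tval: "arith (\<lambda>e F. tval e F s = tval e F t)"
  unfolding arith_def by (rule exI[of _ "Eq s t"]) simp

lemma afun_rename: "afun f \<Longrightarrow> afun (\<lambda>e F. f (\<lambda>i. e (r i)) (\<lambda>i. F (q i)))"
  unfolding afun_def by (drule arith_rename[of _ "case_nat 0 (\<lambda>i. Suc (r i))" q]) simp

lemma afun_shift: "afun f \<Longrightarrow> afun (\<lambda>e F. f (\<lambda>i. e (Suc i)) F)"
  using afun_rename[of f Suc "\<lambda>i. i"] by simp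

text \<open>The language has no symbol for \<open>f\<close>, so its value is introduced by a number
  quantifier and tied down by the graph.\<close>

lemma arith_let:
  assumes "arith (\<lambda>e F. P (\<lambda>i. e (Suc i)) F (e 0))" "afun f"
  shows "arith (\<lambda>e F. P e F (f e F))"
proof -
  have "arith (\<lambda>e F. \<exists>v. v = f e F \<and> P e F v)"
    by (rule arith_ex) (intro arith_conj assms(1) assms(2)[unfolded afun_def])
  then show ?thesis by simp
qed

lemma arith_eq:
  assumes "afun f" "afun g" shows "arith (\<lambda>e F. f e F = g e F)"
proof -
  have "arith (\<lambda>e F. e 0 = g (\<lambda>i. e (Suc i)) F)" using assms(2) unfolding afun_def .
  from arith_let[where P="\<lambda>e F v. v = g e F", OF this assms(1)] show ?thesis .
qed

lemma afun_tval: "afun (\<lambda>e F. tval e F t)"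
proof -
  obtain t' where t': "\<forall>e F. tval e F t' = tval (\<lambda>i. e (Suc i)) F t"
    using tval_rename[of Suc "\<lambda>i. i" t] by blast
  show ?thesis unfolding afun_def
    using arith_tval[of "NVar 0" t'] by (simp only: t' tval.simps)
qed

lemma afun_var: "afun (\<lambda>e F. e i)"
  using afun_tval[of "NVar i"] by simp

lemma afun_graph1:
  assumes h: "arith (\<lambda>e F. e 0 = h (e 1))" and f: "afun f"
  shows "afun (\<lambda>e F. h (f e F))"
  unfolding afun_def
proof (rule arith_let[where P="\<lambda>e F v. e 0 = h v", OF _ afun_shift[OF f]])
  show "arith (\<lambda>e F. e (Suc 0) = h (e 0))"
    using arith_rename[OF h, where r = "case_nat 1 (\<lambda>_. 0)"] by simp
qed

lemma afun_graph2:
  assumes h: "arith (\<lambda>e F. e 0 = h (e 1) (e 2))" and f: "afun f" and g: "afun g"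
  shows "afun (\<lambda>e F. h (f e F) (g e F))"
  unfolding afun_def
proof (rule arith_let[where P="\<lambda>e F v. e 0 = h v (g (\<lambda>i. e (Suc i)) F)", OF _ afun_shift[OF f]],
    rule arith_let[where P="\<lambda>e F v. e (Suc 0) = h (e 0) v", OF _ afun_shift[OF afun_shift[OF g]]])
  show "arith (\<lambda>e F. e (Suc (Suc 0)) = h (e (Suc 0)) (e 0))"
    using arith_rename[OF h, where r = "case_nat 2 (case_nat 1 (\<lambda>_. 0))"]
    by (simp add: numeral_2_eq_2)
qed

lemma afun_plus: "afun f \<Longrightarrow> afun g \<Longrightarrow> afun (\<lambda>e F. f e F + g e F)"
  by (rule afun_graph2) (use arith_tval[of "NVar 0" "Plus (NVar 1) (NVar 2)"] in simp_all)

lemma afun_times: "afun f \<Longrightarrow> afun g \<Longrightarrow> afun (\<lambda>e F. f e F * g e F)"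
  by (rule afun_graph2) (use arith_tval[of "NVar 0" "Times (NVar 1) (NVar 2)"] in simp_all)

lemma afun_Suc: "afun f \<Longrightarrow> afun (\<lambda>e F. Suc (f e F))"
  by (rule afun_graph1) (use arith_tval[of "NVar 0" "Succ (NVar 1)"] in simp_all)

lemma afun_const: "afun (\<lambda>e F. c)"
proof (induction c)
  case 0
  then show ?case using afun_tval[of Zero] by simp
qed (rule afun_Suc)

lemma afun_app: "afun f \<Longrightarrow> afun (\<lambda>e F. F i (f e F))"
proof -
  assume f: "afun f"
  have "arith (\<lambda>e F. e (Suc 0) = F i (e 0))"
    using arith_tval[of "NVar (Suc 0)" "App i (NVar 0)"] by simp
  from arith_let[where P="\<lambda>e F v. e 0 = F i v", OF this afun_shift[OF f]]
  show ?thesis unfolding afun_def .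
qed

lemma afun_areal_app:
  assumes G: "areal G" and f: "afun f" shows "afun (\<lambda>e F. G e F (f e F))"
proof -
  have "arith (\<lambda>e F. e 0 = G (\<lambda>i. e (Suc (Suc i))) F (e (Suc 0)))"
    using G unfolding afun_def by simp
  from arith_rename[OF this, of "case_nat 1 (case_nat 0 (\<lambda>i. Suc (Suc i)))" "\<lambda>i. i"]
  have "arith (\<lambda>e F. e (Suc 0) = G (\<lambda>i. e (Suc (Suc i))) F (e 0))" by simp
  from arith_let[where P="\<lambda>e F v. e 0 = G (\<lambda>i. e (Suc i)) F v", OF this afun_shift[OF f]]
  show ?thesis unfolding afun_def .
qed

lemma arith_le:
  assumes "afun f" "afun g" shows "arith (\<lambda>e F. f e F \<le> g e F)"
proof -
  have "arith (\<lambda>e F. \<exists>n. g e F = f e F + n)"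
    by (intro arith_ex arith_eq afun_plus afun_shift assms afun_var)
  then show ?thesis by (simp add: le_iff_add)
qed

lemma arith_less: "afun f \<Longrightarrow> afun g \<Longrightarrow> arith (\<lambda>e F. f e F < g e F)"
  using arith_le[OF afun_Suc[of f], of g] by (simp add: Suc_le_eq)

lemma afun_if:
  assumes "arith P" "afun f" "afun g"
  shows "afun (\<lambda>e F. if P e F then f e F else g e F)"
proof -
  have P: "arith (\<lambda>e F. P (\<lambda>i. e (Suc i)) F)"
    using arith_rename[OF assms(1), of Suc "\<lambda>i. i"] by simp
  have "arith (\<lambda>e F. (P (\<lambda>i. e (Suc i)) F \<longrightarrow> e 0 = f (\<lambda>i. e (Suc i)) F)
      \<and> (\<not> P (\<lambda>i. e (Suc i)) F \<longrightarrow> e 0 = g (\<lambda>i. e (Suc i)) F))"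
    using assms(2,3) unfolding afun_def by (intro arith_conj arith_imp arith_not P)
  moreover have "(\<lambda>(e::num_env) F. e 0 = (if P (\<lambda>i. e (Suc i)) F then f (\<lambda>i. e (Suc i)) F else g (\<lambda>i. e (Suc i)) F))
    = (\<lambda>e F. (P (\<lambda>i. e (Suc i)) F \<longrightarrow> e 0 = f (\<lambda>i. e (Suc i)) F)
      \<and> (\<not> P (\<lambda>i. e (Suc i)) F \<longrightarrow> e 0 = g (\<lambda>i. e (Suc i)) F))"
    by (intro ext) simp
  ultimately show ?thesis unfolding afun_def by simp
qed

lemma afun_minus:
  assumes "afun f" "afun g" shows "afun (\<lambda>e F. f e F - g e F)"
proof (rule afun_graph2[OF _ assms])
  have "arith (\<lambda>e F. e 1 = e 0 + e 2 \<or> (e 1 \<le> e 2 \<and> e 0 = 0))"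
    by (intro arith_disj arith_conj arith_eq arith_le afun_plus afun_var afun_const)
  moreover have "(\<lambda>(e::num_env) (F::fun_env). e 0 = e 1 - e 2) = (\<lambda>e F. e 1 = e 0 + e 2 \<or> (e 1 \<le> e 2 \<and> e 0 = 0))"
    by (intro ext) auto
  ultimately show "arith (\<lambda>e F. e 0 = e 1 - e 2)" by simp
qed

lemma afun_mod:
  assumes "afun f" "afun g" shows "afun (\<lambda>e F. f e F mod g e F)"
proof (rule afun_graph2[OF _ assms])
  have "arith (\<lambda>e F. (\<exists>q. e 1 = q * e 2 + e 0) \<and> (e 2 = 0 \<or> e 0 < e 2))"
    by (intro arith_disj arith_conj arith_eq arith_less afun_plus afun_times afun_var afun_const arith_ex)
  \<comment> \<open>For \<open>c = 0\<close> the convention \<open>b mod 0 = b\<close> is matched by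
    the equation, which then reads \<open>b = a\<close>.\<close>
  moreover have "a = b mod c \<longleftrightarrow> (\<exists>q. b = q * c + a) \<and> (c = 0 \<or> a < c)" for a b c :: nat
  proof
    assume a: "a = b mod c"
    then have "b = (b div c) * c + a" by simp
    moreover from a have "c = 0 \<or> a < c" by (cases "c = 0") simp_all
    ultimately show "(\<exists>q. b = q * c + a) \<and> (c = 0 \<or> a < c)" by blast
  next
    assume "(\<exists>q. b = q * c + a) \<and> (c = 0 \<or> a < c)"
    then show "a = b mod c" by auto
  qed
  ultimately show "arith (\<lambda>e F. e 0 = e 1 mod e 2)" by simp
qed

section \<open>Pairing of numbers\<close>

definition npair :: "nat \<Rightarrow> nat \<Rightarrow> nat" where "npair a b = prod_encode (a, b)"
definition nfst :: "nat \<Rightarrow> nat" where "nfst n = fst (prod_decode n)"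
definition nsnd :: "nat \<Rightarrow> nat" where "nsnd n = snd (prod_decode n)"

lemma nfst_npair [simp]: "nfst (npair a b) = a" and nsnd_npair [simp]: "nsnd (npair a b) = b"
  by (simp_all add: npair_def nfst_def nsnd_def)

lemma npair_nfst_nsnd [simp]: "npair (nfst n) (nsnd n) = n"
  by (simp add: npair_def nfst_def nsnd_def)

lemma npair_eq_iff [simp]: "npair a b = npair c d \<longleftrightarrow> a = c \<and> b = d"
  by (simp add: npair_def)

lemma npair_0_0: "npair 0 0 = 0"
  by (simp add: npair_def prod_encode_def)

lemma nfst_0 [simp]: "nfst 0 = 0" and nsnd_0 [simp]: "nsnd 0 = 0"
  using nfst_npair[of 0 0] nsnd_npair[of 0 0] by (simp_all add: npair_0_0)

lemma nfst_le: "nfst n \<le> n" and nsnd_le: "nsnd n \<le> n"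
  using le_prod_encode_1[of "nfst n" "nsnd n"] le_prod_encode_2[of "nsnd n" "nfst n"]
  by (simp_all flip: npair_def)

text \<open>The pair of \<open>a\<close> and \<open>b\<close> is
  \<open>triangle (a + b) + a\<close>, which exceeds \<open>b\<close> once \<open>a\<close> is
  nonzero. This makes codes larger than their arguments, so that \<open>ev\<close>
  terminates.\<close>

lemma nsnd_less: "nfst n \<noteq> 0 \<Longrightarrow> nsnd n < n"
proof -
  assume n: "nfst n \<noteq> 0"
  have "nsnd n \<le> triangle (nfst n + nsnd n)" by (cases "nfst n + nsnd n") (auto simp: triangle_Suc)
  then have "nsnd n < triangle (nfst n + nsnd n) + nfst n" using n by simp
  also have "\<dots> = npair (nfst n) (nsnd n)" unfolding npair_def prod_encode_def by simp
  finally show ?thesis by simp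
qed

text \<open>Doubling clears the division in the triangular numbers and leaves a polynomial
  equation.\<close>

lemma npair_graph: "p = npair a b \<longleftrightarrow> 2 * p = (a + b) * Suc (a + b) + 2 * a"
proof -
  have "k * Suc k = 2 * triangle k" for k
    unfolding triangle_def by (rule dvd_mult_div_cancel[symmetric]) simp
  then have "(a + b) * Suc (a + b) = 2 * triangle (a + b)" .
  moreover have "p = t + a \<longleftrightarrow> 2 * p = 2 * t + 2 * a" for t by linarith
  ultimately show ?thesis unfolding npair_def prod_encode_def by (simp only: prod.case)
qed

lemma afun_npair:
  assumes "afun f" "afun g" shows "afun (\<lambda>e F. npair (f e F) (g e F))"
proof (rule afun_graph2[where h = npair, OF _ assms])
  show "arith (\<lambda>e F. e 0 = npair (e 1) (e 2))"
    unfolding npair_graph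
    by (intro arith_eq afun_times afun_plus afun_Suc afun_const afun_var)
qed

lemma afun_nfst: "afun f \<Longrightarrow> afun (\<lambda>e F. nfst (f e F))"
proof (rule afun_graph1[where h = nfst])
  have "arith (\<lambda>e F. \<exists>b. e 1 = npair (e 0) b)" by (intro arith_ex arith_eq afun_npair afun_var)
  moreover have "(\<exists>b. p = npair a b) \<longleftrightarrow> a = nfst p" for a p by (metis nfst_npair npair_nfst_nsnd)
  ultimately show "arith (\<lambda>e F. e 0 = nfst (e 1))" by simp
qed

lemma afun_nsnd: "afun f \<Longrightarrow> afun (\<lambda>e F. nsnd (f e F))"
proof (rule afun_graph1[where h = nsnd])
  have "arith (\<lambda>e F. \<exists>a. e 1 = npair a (e 0))" by (intro arith_ex arith_eq afun_npair afun_var)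
  moreover have "(\<exists>a. p = npair a b) \<longleftrightarrow> b = nsnd p" for b p by (metis nsnd_npair npair_nfst_nsnd)
  ultimately show "arith (\<lambda>e F. e 0 = nsnd (e 1))" by simp
qed

lemmas afun_intros = afun_var afun_const afun_app afun_plus afun_times afun_Suc afun_minus afun_mod
  afun_npair afun_nfst afun_nsnd afun_if

lemmas arith_intros = arith_not arith_conj arith_disj arith_imp arith_all arith_ex
  arith_eq arith_le arith_less

section \<open>Simultaneous substitution\<close>

lemma afun_tval_subst:
  assumes "\<And>i. afun (\<lambda>e F. E e F i)" "\<And>i. areal (\<lambda>e F. G e F i)"
  shows "afun (\<lambda>e F. tval (E e F) (G e F) t)"
proof (induction t)
  case (App i t)
  show ?case unfolding tval.simps
    by (rule afun_areal_app[of "\<lambda>e F. G e F i", OF assms(2) App.IH])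
qed (simp_all only: tval.simps, (intro assms(1) afun_const afun_Suc afun_plus afun_times; assumption)+)

text \<open>Induction on the formula, with \<open>E\<close> and \<open>G\<close> general because
  each quantifier shifts them. Replacing function variables by defined functions is what later
  splits one witness into columns.\<close>

lemma arith_subst:
  assumes "arith P" "\<And>i. afun (\<lambda>e F. E e F i)" "\<And>i. areal (\<lambda>e F. G e F i)"
  shows "arith (\<lambda>e F. P (E e F) (G e F))"
proof -
  have "arith (\<lambda>e F. asat (E e F) (G e F) \<phi>)" for \<phi>
    using assms(2,3)
  proof (induction \<phi> arbitrary: E G)
    case (Eq s t)
    then show ?case unfolding asat.simps by (intro arith_eq afun_tval_subst)
  next
    case (Neg p)
    then show ?case unfolding asat.simps by (intro arith_not Neg.IH)
  next
    case (Conj p q)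
    then show ?case unfolding asat.simps by (intro arith_conj Conj.IH)
  next
    case (All p)
    have "arith (\<lambda>e F. asat (case_nat (e 0) (E (\<lambda>i. e (Suc i)) F)) (G (\<lambda>i. e (Suc i)) F) p)"
    proof (rule All.IH)
      show "afun (\<lambda>e F. case_nat (e 0) (E (\<lambda>i. e (Suc i)) F) i)" for i
        by (cases i) (simp_all add: afun_var afun_shift[OF All.prems(1)])
      show "areal (\<lambda>e F. G (\<lambda>i. e (Suc i)) F i)" for i
        using afun_rename[OF All.prems(2)[of i], of "case_nat 0 (\<lambda>i. Suc (Suc i))" "\<lambda>i. i"] by simp
    qed
    then show ?case unfolding asat.simps by (intro arith_all)
  qed
  then show ?thesis using assms(1) unfolding arith_def by fast
qed

section \<open>Closure properties of the analytical classes\<close>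

text \<open>The environment version of \<open>Sigma11\<close>: relations may mention any variables,
  so the closure properties need no count of arguments.\<close>

definition sig11 :: "(num_env \<Rightarrow> fun_env \<Rightarrow> bool) \<Rightarrow> bool" where
  "sig11 P \<longleftrightarrow> (\<exists>Q. arith Q \<and> (\<forall>e F. P e F \<longleftrightarrow> (\<exists>y. Q e (case_nat y F))))"

definition pi11 :: "(num_env \<Rightarrow> fun_env \<Rightarrow> bool) \<Rightarrow> bool" where
  "pi11 P \<longleftrightarrow> sig11 (\<lambda>e F. \<not> P e F)"

lemma sig11I: "arith Q \<Longrightarrow> (\<And>e F. P e F \<longleftrightarrow> (\<exists>y. Q e (case_nat y F))) \<Longrightarrow> sig11 P"
  unfolding sig11_def by blast

lemma sig11E:
  assumes "sig11 P"
  obtains Q where "arith Q" "\<And>e F. P e F \<longleftrightarrow> (\<exists>y. Q e (case_nat y F))"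
  using assms unfolding sig11_def by blast

lemma sig11_arith:
  assumes "arith P" shows "sig11 P"
proof (rule sig11I)
  show "arith (\<lambda>e F. P e (\<lambda>i. F (Suc i)))"
    by (rule arith_rename[OF assms, of "\<lambda>i. i" Suc])
qed simp

lemma sig11_disj:
  assumes "sig11 P" "sig11 P'" shows "sig11 (\<lambda>e F. P e F \<or> P' e F)"
proof -
  obtain Q where Q: "arith Q" "\<And>e F. P e F \<longleftrightarrow> (\<exists>y. Q e (case_nat y F))"
    using sig11E[OF assms(1)] by blast
  obtain Q' where Q': "arith Q'" "\<And>e F. P' e F \<longleftrightarrow> (\<exists>y. Q' e (case_nat y F))"
    using sig11E[OF assms(2)] by blast
  show ?thesis by (rule sig11I[OF arith_disj[OF Q(1) Q'(1)]]) (auto simp: Q(2) Q'(2))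
qed

lemma sig11_exn:
  assumes "sig11 (\<lambda>e F. P (\<lambda>i. e (Suc i)) F (e 0))"
  shows "sig11 (\<lambda>e F. \<exists>n. P e F n)"
proof -
  obtain Q where Q: "arith Q" "\<And>e F. P (\<lambda>i. e (Suc i)) F (e 0) \<longleftrightarrow> (\<exists>y. Q e (case_nat y F))"
    using sig11E[OF assms] by blast
  have "arith (\<lambda>e F. \<exists>n. Q (case_nat n e) F)"
  proof (rule arith_ex, rule arith_subst[OF Q(1)])
    show "afun (\<lambda>e F. case_nat (e 0) (\<lambda>i. e (Suc i)) i)" for i
      by (cases i) (simp_all add: afun_var)
  qed (intro afun_app afun_var)
  then show ?thesis
  proof (rule sig11I)
    fix e F
    have "P e F n \<longleftrightarrow> (\<exists>y. Q (case_nat n e) (case_nat y F))" for n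
      using Q(2)[of "case_nat n e" F] by simp
    then show "(\<exists>n. P e F n) \<longleftrightarrow> (\<exists>y n. Q (case_nat n e) (case_nat y F))" by blast
  qed
qed

text \<open>Countable choice merges the witnesses for all \<open>n\<close> into one function, whose
  column \<open>n\<close> serves \<open>n\<close>.\<close>

lemma sig11_alln:
  assumes "sig11 (\<lambda>e F. P (\<lambda>i. e (Suc i)) F (e 0))"
  shows "sig11 (\<lambda>e F. \<forall>n. P e F n)"
proof -
  obtain Q where Q: "arith Q" "\<And>e F. P (\<lambda>i. e (Suc i)) F (e 0) \<longleftrightarrow> (\<exists>y. Q e (case_nat y F))"
    using sig11E[OF assms] by blast
  have "arith (\<lambda>e F. \<forall>n. Q (case_nat n e) (case_nat (\<lambda>k. F 0 (npair n k)) (\<lambda>i. F (Suc i))))"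
  proof (rule arith_all, rule arith_subst[OF Q(1)])
    show "afun (\<lambda>e F. case_nat (e 0) (\<lambda>i. e (Suc i)) i)" for i
      by (cases i) (simp_all add: afun_var)
    show "areal (\<lambda>e F. case_nat (\<lambda>k. F 0 (npair (e 0) k)) (\<lambda>i. F (Suc i)) i)" for i
      by (cases i) (simp_all, (intro afun_intros)+)
  qed
  then show ?thesis
  proof (rule sig11I)
    fix e F
    have *: "P e F n \<longleftrightarrow> (\<exists>y. Q (case_nat n e) (case_nat y F))" for n
      using Q(2)[of "case_nat n e" F] by simp
    show "(\<forall>n. P e F n) \<longleftrightarrow> (\<exists>y. \<forall>n. Q (case_nat n e) (case_nat (\<lambda>k. case_nat y F 0 (npair n k))
        (\<lambda>i. case_nat y F (Suc i))))"
    proof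
      assume "\<forall>n. P e F n"
      then obtain y where y: "\<And>n. Q (case_nat n e) (case_nat (y n) F)"
        unfolding * by metis
      then show "\<exists>y. \<forall>n. Q (case_nat n e) (case_nat (\<lambda>k. case_nat y F 0 (npair n k))
        (\<lambda>i. case_nat y F (Suc i)))"
        by (intro exI[of _ "\<lambda>p. y (nfst p) (nsnd p)"]) simp
    next
      assume "\<exists>y. \<forall>n. Q (case_nat n e) (case_nat (\<lambda>k. case_nat y F 0 (npair n k))
        (\<lambda>i. case_nat y F (Suc i)))"
      then show "\<forall>n. P e F n" unfolding * by auto
    qed
  qed
qed

text \<open>The two witnesses become columns 0 and 1 of a single function.\<close>

lemma sig11_conj:
  assumes "sig11 P" "sig11 P'" shows "sig11 (\<lambda>e F. P e F \<and> P' e F)"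
proof -
  obtain Q where Q: "arith Q" "\<And>e F. P e F \<longleftrightarrow> (\<exists>y. Q e (case_nat y F))"
    using sig11E[OF assms(1)] by blast
  obtain Q' where Q': "arith Q'" "\<And>e F. P' e F \<longleftrightarrow> (\<exists>y. Q' e (case_nat y F))"
    using sig11E[OF assms(2)] by blast
  have col: "arith (\<lambda>e F. R e (case_nat (\<lambda>k. F 0 (npair j k)) (\<lambda>i. F (Suc i))))"
    if "arith R" for R and j :: nat
  proof (rule arith_subst[OF that])
    show "areal (\<lambda>e F. case_nat (\<lambda>k. F 0 (npair j k)) (\<lambda>i. F (Suc i)) i)" for i
      by (cases i) (simp_all, (intro afun_intros)+)
  qed (rule afun_var)
  show ?thesis
  proof (rule sig11I[OF arith_conj[OF col[OF Q(1), of 0] col[OF Q'(1), of 1]]])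
    fix e F
    show "P e F \<and> P' e F \<longleftrightarrow> (\<exists>z. Q e (case_nat (\<lambda>k. case_nat z F 0 (npair 0 k)) (\<lambda>i. case_nat z F (Suc i)))
      \<and> Q' e (case_nat (\<lambda>k. case_nat z F 0 (npair 1 k)) (\<lambda>i. case_nat z F (Suc i))))"
    proof
      assume "P e F \<and> P' e F"
      then obtain y y' where "Q e (case_nat y F)" "Q' e (case_nat y' F)" using Q(2) Q'(2) by blast
      then show "\<exists>z. Q e (case_nat (\<lambda>k. case_nat z F 0 (npair 0 k)) (\<lambda>i. case_nat z F (Suc i)))
      \<and> Q' e (case_nat (\<lambda>k. case_nat z F 0 (npair 1 k)) (\<lambda>i. case_nat z F (Suc i)))"
        by (intro exI[of _ "\<lambda>p. if nfst p = 0 then y (nsnd p) else y' (nsnd p)"]) simp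
    next
      assume "\<exists>z. Q e (case_nat (\<lambda>k. case_nat z F 0 (npair 0 k)) (\<lambda>i. case_nat z F (Suc i)))
      \<and> Q' e (case_nat (\<lambda>k. case_nat z F 0 (npair 1 k)) (\<lambda>i. case_nat z F (Suc i)))"
      then show "P e F \<and> P' e F" using Q(2) Q'(2) by auto
    qed
  qed
qed

text \<open>Two function quantifiers contract to one: column 0 holds the inner witness, column 1
  holds \<open>y\<close>.\<close>

lemma sig11_exr:
  assumes "sig11 (\<lambda>e F. P e (\<lambda>i. F (Suc i)) (F 0))"
  shows "sig11 (\<lambda>e F. \<exists>y. P e F y)"
proof -
  obtain Q where Q: "arith Q" "\<And>e F. P e (\<lambda>i. F (Suc i)) (F 0) \<longleftrightarrow> (\<exists>y. Q e (case_nat y F))"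
    using sig11E[OF assms] by blast
  have "arith (\<lambda>e F. Q e (case_nat (\<lambda>k. F 0 (npair 0 k)) (case_nat (\<lambda>k. F 0 (npair 1 k)) (\<lambda>i. F (Suc i)))))"
  proof (rule arith_subst[OF Q(1)])
    show "areal (\<lambda>e F. case_nat (\<lambda>k. F 0 (npair 0 k)) (case_nat (\<lambda>k. F 0 (npair 1 k)) (\<lambda>i. F (Suc i))) i)" for i
    proof (cases i)
      case (Suc j)
      then show ?thesis by (cases j) (simp_all, (intro afun_intros)+)
    qed (simp, intro afun_intros)
  qed (rule afun_var)
  then show ?thesis
  proof (rule sig11I)
    fix e F
    have *: "P e F y \<longleftrightarrow> (\<exists>z. Q e (case_nat z (case_nat y F)))" for y
      using Q(2)[of e "case_nat y F"] by simp
    show "(\<exists>y. P e F y) \<longleftrightarrow> (\<exists>z. Q e (case_nat (\<lambda>k. case_nat z F 0 (npair 0 k)) (case_nat (\<lambda>k. case_nat z F 0 (npair 1 k)) (\<lambda>i. case_nat z F (Suc i)))))"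
    proof
      assume "\<exists>y. P e F y"
      then obtain y z where "Q e (case_nat z (case_nat y F))" using * by blast
      then show "\<exists>z. Q e (case_nat (\<lambda>k. case_nat z F 0 (npair 0 k)) (case_nat (\<lambda>k. case_nat z F 0 (npair 1 k)) (\<lambda>i. case_nat z F (Suc i))))"
        by (intro exI[of _ "\<lambda>p. if nfst p = 0 then z (nsnd p) else y (nsnd p)"]) simp
    next
      assume "\<exists>z. Q e (case_nat (\<lambda>k. case_nat z F 0 (npair 0 k)) (case_nat (\<lambda>k. case_nat z F 0 (npair 1 k)) (\<lambda>i. case_nat z F (Suc i))))"
      then show "\<exists>y. P e F y" unfolding * by auto
    qed
  qed
qed

lemma sig11_subst:
  assumes "sig11 P" and E: "\<And>i. afun (\<lambda>e F. E e F i)" and G: "\<And>i. areal (\<lambda>e F. G e F i)"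
  shows "sig11 (\<lambda>e F. P (E e F) (G e F))"
proof -
  obtain Q where Q: "arith Q" "\<And>e F. P e F \<longleftrightarrow> (\<exists>y. Q e (case_nat y F))"
    using sig11E[OF assms(1)] by blast
  have "arith (\<lambda>e F. Q (E e (\<lambda>i. F (Suc i))) (case_nat (F 0) (G e (\<lambda>i. F (Suc i)))))"
  proof (rule arith_subst[OF Q(1)])
    show "afun (\<lambda>e F. E e (\<lambda>i. F (Suc i)) i)" for i
      using afun_rename[OF E[of i], of "\<lambda>i. i" Suc] by simp
    show "areal (\<lambda>e F. case_nat (F 0) (G e (\<lambda>i. F (Suc i))) i)" for i
    proof (cases i)
      case 0
      then show ?thesis by (simp add: afun_app afun_var)
    next
      case (Suc j)
      then show ?thesis using afun_rename[OF G[of j], of "\<lambda>i. i" Suc] by simp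
    qed
  qed
  then show ?thesis by (rule sig11I) (simp add: Q(2))
qed

lemma pi11_arith: "arith P \<Longrightarrow> pi11 P"
  unfolding pi11_def by (intro sig11_arith arith_not)

lemma sig11_not: "pi11 P \<Longrightarrow> sig11 (\<lambda>e F. \<not> P e F)"
  unfolding pi11_def .

lemma pi11_not: "sig11 P \<Longrightarrow> pi11 (\<lambda>e F. \<not> P e F)"
  unfolding pi11_def by simp

lemma sig11_imp: "pi11 P \<Longrightarrow> sig11 Q \<Longrightarrow> sig11 (\<lambda>e F. P e F \<longrightarrow> Q e F)"
  unfolding imp_conv_disj by (intro sig11_disj sig11_not)

lemma pi11_conj: "pi11 P \<Longrightarrow> pi11 Q \<Longrightarrow> pi11 (\<lambda>e F. P e F \<and> Q e F)"
  unfolding pi11_def by (simp only: de_Morgan_conj) (rule sig11_disj)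

lemma pi11_disj: "pi11 P \<Longrightarrow> pi11 Q \<Longrightarrow> pi11 (\<lambda>e F. P e F \<or> Q e F)"
  unfolding pi11_def by (simp only: de_Morgan_disj) (rule sig11_conj)

lemma pi11_imp: "sig11 P \<Longrightarrow> pi11 Q \<Longrightarrow> pi11 (\<lambda>e F. P e F \<longrightarrow> Q e F)"
  unfolding imp_conv_disj by (intro pi11_disj pi11_not)

lemma pi11_alln: "pi11 (\<lambda>e F. P (\<lambda>i. e (Suc i)) F (e 0)) \<Longrightarrow> pi11 (\<lambda>e F. \<forall>n. P e F n)"
  unfolding pi11_def by (simp only: not_all) (rule sig11_exn)

lemma pi11_exn: "pi11 (\<lambda>e F. P (\<lambda>i. e (Suc i)) F (e 0)) \<Longrightarrow> pi11 (\<lambda>e F. \<exists>n. P e F n)"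
  unfolding pi11_def by (simp only: not_ex) (rule sig11_alln)

lemma pi11_allr: "pi11 (\<lambda>e F. P e (\<lambda>i. F (Suc i)) (F 0)) \<Longrightarrow> pi11 (\<lambda>e F. \<forall>y. P e F y)"
  unfolding pi11_def by (simp only: not_all) (rule sig11_exr)

section \<open>Lists of arguments and environments\<close>

lemma fenv_Cons: "fenv (y # xs) = case_nat y (fenv xs)"
  by (auto simp: fenv_def fun_eq_iff split: nat.split)

lemma nenv_Cons: "nenv (n # ns) = case_nat n (nenv ns)"
  by (auto simp: nenv_def fun_eq_iff split: nat.split)

lemma fenv_Nil: "fenv [] = (\<lambda>_ _. 0)" and nenv_Nil: "nenv [] = (\<lambda>_. 0)"
  by (auto simp: fenv_def nenv_def fun_eq_iff)

lemma Sigma11_iff: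
  "Sigma11 k l P \<longleftrightarrow> (\<exists>P'. sig11 P' \<and> (\<forall>ns xs. length ns = k \<longrightarrow> length xs = l \<longrightarrow>
     (P ns xs \<longleftrightarrow> P' (nenv ns) (fenv xs))))"
proof
  assume "Sigma11 k l P"
  then obtain \<phi> where \<phi>: "\<And>ns xs. length ns = k \<Longrightarrow> length xs = l \<Longrightarrow>
      P ns xs \<longleftrightarrow> (\<exists>y. asat (nenv ns) (fenv (y # xs)) \<phi>)" unfolding Sigma11_def by blast
  have "sig11 (\<lambda>e F. \<exists>y. asat e (case_nat y F) \<phi>)"
    by (rule sig11I[where Q = "\<lambda>e F. asat e F \<phi>"]) (auto simp: arith_def)
  then show "\<exists>P'. sig11 P' \<and> (\<forall>ns xs. length ns = k \<longrightarrow> length xs = l \<longrightarrow>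
     (P ns xs \<longleftrightarrow> P' (nenv ns) (fenv xs)))"
    by (intro exI conjI) (auto simp: \<phi> fenv_Cons)
next
  assume "\<exists>P'. sig11 P' \<and> (\<forall>ns xs. length ns = k \<longrightarrow> length xs = l \<longrightarrow>
     (P ns xs \<longleftrightarrow> P' (nenv ns) (fenv xs)))"
  then show "Sigma11 k l P" unfolding Sigma11_def sig11_def arith_def
    by (metis fenv_Cons)
qed

lemma Delta11I:
  assumes "sig11 P'" "pi11 P'"
    "\<And>ns xs. length ns = k \<Longrightarrow> length xs = l \<Longrightarrow> P ns xs \<longleftrightarrow> P' (nenv ns) (fenv xs)"
  shows "Delta11 k l P"
  using assms unfolding Delta11_def Pi11_def Sigma11_iff pi11_def by blast

section \<open>A universal truth function\<close>

text \<open>Environments are iterated pairs. As 0 codes the pair of zeros, variables beyond the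
  coded ones read 0, in agreement with \<open>nenv\<close>.\<close>

primrec code_env :: "nat \<Rightarrow> nat \<Rightarrow> nat" where
  "code_env s 0 = nfst s"
| "code_env s (Suc i) = code_env (nsnd s) i"

lemma code_env_npair: "code_env (npair n s) = case_nat n (code_env s)"
  by (auto simp: fun_eq_iff split: nat.split)

lemma code_env_0: "code_env 0 = (\<lambda>_. 0)"
proof
  show "code_env 0 i = 0" for i by (induction i) auto
qed

text \<open>
  A code is a pair of a tag and an argument; tags 0 to 6 are for terms, 7 to 10 for formulas, with
  any truth value other than 0 standing for true. Tag 11 belongs to no formula: it makes the values
  of \<open>y\<close> entries of the table of all values of \<open>ev\<close>, so that a single table also carries \<open>y\<close>.
\<close>

function ev :: "baire \<Rightarrow> baire \<Rightarrow> nat \<Rightarrow> nat \<Rightarrow> nat" where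
  "ev y x c s =
    (if nfst c = 0 then code_env s (nsnd c)
     else if nfst c = 1 then 0
     else if nfst c = 2 then Suc (ev y x (nsnd c) s)
     else if nfst c = 3 then ev y x (nfst (nsnd c)) s + ev y x (nsnd (nsnd c)) s
     else if nfst c = 4 then ev y x (nfst (nsnd c)) s * ev y x (nsnd (nsnd c)) s
     else if nfst c = 5 then y (ev y x (nsnd c) s)
     else if nfst c = 6 then x (ev y x (nsnd c) s)
     else if nfst c = 7 then (if ev y x (nfst (nsnd c)) s = ev y x (nsnd (nsnd c)) s then 1 else 0)
     else if nfst c = 8 then (if ev y x (nsnd c) s = 0 then 1 else 0)
     else if nfst c = 9 then ev y x (nfst (nsnd c)) s * ev y x (nsnd (nsnd c)) s
     else if nfst c = 10 then (if \<forall>n. ev y x (nsnd c) (npair n s) \<noteq> 0 then 1 else 0)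
     else if nfst c = 11 then y s
     else 0)"
  by auto
termination
\<comment> \<open>Only the code decreases; the environment \<open>s\<close> grows under a
  quantifier.\<close>
proof (relation "measure (\<lambda>(y, x, c, s). c)")
  have "nfst (nsnd c) < c" "nsnd (nsnd c) < c" if "nfst c \<noteq> 0" for c
    using nsnd_less[OF that] nfst_le[of "nsnd c"] nsnd_le[of "nsnd c"] by auto
qed (simp_all add: nsnd_less le_less_trans[OF nfst_le nsnd_less] le_less_trans[OF nsnd_le nsnd_less])

declare ev.simps [simp del]

text \<open>In \<open>fenv [y, x]\<close> every function variable past 1 is constantly 0, so its
  applications get the code of \<open>Zero\<close>.\<close>

primrec tcode :: "atm \<Rightarrow> nat" where
  "tcode (NVar i) = npair 0 i"
| "tcode Zero = npair 1 0"
| "tcode (Succ t) = npair 2 (tcode t)"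
| "tcode (Plus s t) = npair 3 (npair (tcode s) (tcode t))"
| "tcode (Times s t) = npair 4 (npair (tcode s) (tcode t))"
| "tcode (App i t) = (if i = 0 then npair 5 (tcode t) else if i = 1 then npair 6 (tcode t) else npair 1 0)"

primrec fcode :: "afm \<Rightarrow> nat" where
  "fcode (Eq s t) = npair 7 (npair (tcode s) (tcode t))"
| "fcode (Neg p) = npair 8 (fcode p)"
| "fcode (Conj p q) = npair 9 (npair (fcode p) (fcode q))"
| "fcode (All p) = npair 10 (fcode p)"

lemma fenv_2: "fenv [y, x] i = (if i = 0 then y else if i = 1 then x else (\<lambda>_. 0))"
  by (simp add: fenv_def nth_Cons split: nat.split)

lemma ev_tcode: "ev y x (tcode t) s = tval (code_env s) (fenv [y, x]) t"
proof (induction t)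
  case (NVar i)
  show ?case by (subst ev.simps) simp
next
  case Zero
  show ?case by (subst ev.simps) simp
next
  case (Succ t)
  then show ?case by (subst ev.simps) simp
next
  case (Plus t1 t2)
  then show ?case by (subst ev.simps) simp
next
  case (Times t1 t2)
  then show ?case by (subst ev.simps) simp
next
  case (App i t)
  then show ?case by (subst ev.simps) (simp add: fenv_2[of y x i])
qed

lemma ev_fcode: "ev y x (fcode p) s \<noteq> 0 \<longleftrightarrow> asat (code_env s) (fenv [y, x]) p"
proof (induction p arbitrary: s)
  case (Eq t1 t2)
  show ?case by (subst ev.simps) (simp add: ev_tcode)
next
  case (Neg p)
  show ?case using Neg[of s] by (subst ev.simps) auto
next
  case (Conj p1 p2)
  then show ?case by (subst ev.simps) simp
next
  case (All p)
  then show ?case by (subst ev.simps) (simp add: code_env_npair)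
qed

lemma arith_code:
  assumes "arith P"
  obtains c where "\<And>y x s. ev y x c s \<noteq> 0 \<longleftrightarrow> P (code_env s) (fenv [y, x])"
proof -
  obtain p where "\<forall>e F. P e F \<longleftrightarrow> asat e F p" using assms unfolding arith_def by blast
  then show ?thesis using that[of "fcode p"] ev_fcode by blast
qed

text \<open>
  In a valid table \<open>z\<close> the entry at \<open>npair c s\<close> is a pair: the value of the code \<open>c\<close> at \<open>s\<close>, and a
  Skolem witness which is a counterexample if \<open>c\<close> codes a false universal formula. Thanks to the
  witnesses, validity constrains only three entries at a time, hence is a closed condition on \<open>z\<close>.
\<close>

definition local_ok :: "baire \<Rightarrow> nat \<Rightarrow> nat \<Rightarrow> nat \<Rightarrow> nat \<Rightarrow> nat \<Rightarrow> nat \<Rightarrow> bool" where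
  "local_ok x p u q v r w \<longleftrightarrow>
    (nfst (nfst p) = 0 \<and> nsnd (nfst p) = 0 \<longrightarrow> nfst u = nfst (nsnd p)) \<and>
    (nfst (nfst p) = 0 \<and> nsnd (nfst p) \<noteq> 0 \<and> q = npair (npair 0 (nsnd (nfst p) - 1)) (nsnd (nsnd p)) \<longrightarrow> nfst u = nfst v) \<and>
    (nfst (nfst p) = 1 \<longrightarrow> nfst u = 0) \<and>
    (nfst (nfst p) = 2 \<and> q = npair (nsnd (nfst p)) (nsnd p) \<longrightarrow> nfst u = Suc (nfst v)) \<and>
    (nfst (nfst p) = 3 \<and> q = npair (nfst (nsnd (nfst p))) (nsnd p) \<and> r = npair (nsnd (nsnd (nfst p))) (nsnd p) \<longrightarrow> nfst u = nfst v + nfst w) \<and>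
    (nfst (nfst p) = 4 \<and> q = npair (nfst (nsnd (nfst p))) (nsnd p) \<and> r = npair (nsnd (nsnd (nfst p))) (nsnd p) \<longrightarrow> nfst u = nfst v * nfst w) \<and>
    (nfst (nfst p) = 5 \<and> q = npair (nsnd (nfst p)) (nsnd p) \<and> r = npair (npair 11 0) (nfst v) \<longrightarrow> nfst u = nfst w) \<and>
    (nfst (nfst p) = 6 \<and> q = npair (nsnd (nfst p)) (nsnd p) \<longrightarrow> nfst u = x (nfst v)) \<and>
    (nfst (nfst p) = 7 \<and> q = npair (nfst (nsnd (nfst p))) (nsnd p) \<and> r = npair (nsnd (nsnd (nfst p))) (nsnd p) \<longrightarrow>
       nfst u = (if nfst v = nfst w then 1 else 0)) \<and>
    (nfst (nfst p) = 8 \<and> q = npair (nsnd (nfst p)) (nsnd p) \<longrightarrow> nfst u = (if nfst v = 0 then 1 else 0)) \<and>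
    (nfst (nfst p) = 9 \<and> q = npair (nfst (nsnd (nfst p))) (nsnd p) \<and> r = npair (nsnd (nsnd (nfst p))) (nsnd p) \<longrightarrow> nfst u = nfst v * nfst w) \<and>
    (nfst (nfst p) = 10 \<longrightarrow> nfst u \<le> 1) \<and>
    (nfst (nfst p) = 10 \<and> nfst u \<noteq> 0 \<and> nfst q = nsnd (nfst p) \<and> nsnd (nsnd q) = nsnd p \<longrightarrow> nfst v \<noteq> 0) \<and>
    (nfst (nfst p) = 10 \<and> nfst u = 0 \<and> q = npair (nsnd (nfst p)) (npair (nsnd u) (nsnd p)) \<longrightarrow> nfst v = 0) \<and>
    (nfst (nfst p) = 11 \<and> nsnd (nfst p) \<noteq> 0 \<and> q = npair (npair 11 0) (nsnd p) \<longrightarrow> nfst u = nfst v) \<and>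
    (nfst (nfst p) > 11 \<longrightarrow> nfst u = 0)"

definition valid :: "baire \<Rightarrow> baire \<Rightarrow> bool" where
  "valid z x \<longleftrightarrow> (\<forall>p q r. local_ok x p (z p) q (z q) r (z r))"

lemma ev_10: "nfst c = 10 \<Longrightarrow> ev y x c s = (if \<forall>n. ev y x (nsnd c) (npair n s) \<noteq> 0 then 1 else 0)"
  by (subst ev.simps) simp

text \<open>Once the entries of tag 11 are those of \<open>y\<close>, the local conditions force the
  first component of every other entry, by induction on the code.\<close>

lemma valid_imp_ev:
  assumes "valid z x" and Y: "\<And>k. nfst (z (npair (npair 11 0) k)) = y k"
  shows "nfst (z (npair c s)) = ev y x c s"
proof (induction c arbitrary: s rule: less_induct)
  case (less c)
  note local_ok = assms(1)[unfolded valid_def local_ok_def, rule_format]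
  have IH: "nfst (z (npair (nsnd c) s)) = ev y x (nsnd c) s"
    "nfst (z (npair (nfst (nsnd c)) s)) = ev y x (nfst (nsnd c)) s"
    "nfst (z (npair (nsnd (nsnd c)) s)) = ev y x (nsnd (nsnd c)) s" if "nfst c \<noteq> 0" for s
    by (rule less.IH[OF nsnd_less[OF that]], rule less.IH[OF le_less_trans[OF nfst_le nsnd_less[OF that]]],
        rule less.IH[OF le_less_trans[OF nsnd_le nsnd_less[OF that]]])
  \<comment> \<open>The clauses for variables walk down the index along the tail of the environment.
    \<open>IH\<close> covers nonzero tags only, hence the separate induction.\<close>
  have nvar: "nfst (z (npair (npair 0 i) s)) = code_env s i" for i s
  proof (induction i arbitrary: s)
    case 0
    then show ?case using local_ok[of "npair (npair 0 0) s"] by simp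
  next
    case (Suc i)
    then show ?case using local_ok[of "npair (npair 0 (Suc i)) s" "npair (npair 0 i) (nsnd s)"] by simp
  qed
  \<comment> \<open>For tag 5 the third position depends on an entry: it is where the table stores
    \<open>y\<close> at the value of the argument.\<close>
  note * = local_ok[of "npair c s" "npair (nsnd c) s" "npair (npair 11 0) (nfst (z (npair (nsnd c) s)))"]
    local_ok[of "npair c s" "npair (nfst (nsnd c)) s" "npair (nsnd (nsnd c)) s"]
  consider "nfst c = 0" | "nfst c = 10" | "nfst c = 11" | "nfst c \<noteq> 0" "nfst c \<noteq> 10" "nfst c \<noteq> 11" by blast
  then show ?case
  proof cases
    case 1
    then show ?thesis using nvar[of "nsnd c" s] by (subst ev.simps) (simp, metis npair_nfst_nsnd)
  next
    case 2
    have c0: "nfst c \<noteq> 0" using 2 by simp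
    have "nfst (z (npair c s)) = (if \<forall>n. ev y x (nsnd c) (npair n s) \<noteq> 0 then 1 else 0)"
    proof (cases "nfst (z (npair c s)) = 0")
      \<comment> \<open>A universal entry with value 0 carries its counterexample in the second
        component.\<close>
      case True
      then have "nfst (z (npair (nsnd c) (npair (nsnd (z (npair c s))) s))) = 0"
        using local_ok[of "npair c s" "npair (nsnd c) (npair (nsnd (z (npair c s))) s)"] 2 by simp
      then have "ev y x (nsnd c) (npair (nsnd (z (npair c s))) s) = 0"
        by (simp only: IH(1)[OF c0])
      then have "\<not> (\<forall>n. ev y x (nsnd c) (npair n s) \<noteq> 0)" by blast
      with True show ?thesis by (simp only: if_False)
    next
      case False
      have "nfst (z (npair (nsnd c) (npair n s))) \<noteq> 0" for n
        using local_ok[of "npair c s" "npair (nsnd c) (npair n s)"] False 2 by simp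
      then have "ev y x (nsnd c) (npair n s) \<noteq> 0" for n
        by (simp only: IH(1)[OF c0] not_False_eq_True)
      then have *: "\<forall>n. ev y x (nsnd c) (npair n s) \<noteq> 0" by blast
      have "nfst (z (npair c s)) \<le> 1" using local_ok[of "npair c s"] 2 by simp
      with False have "nfst (z (npair c s)) = 1" by linarith
      with * show ?thesis by (simp only: if_True simp_thms)
    qed
    then show ?thesis by (simp only: ev_10[OF 2])
  next
    case 3
    then show ?thesis
      using local_ok[of "npair c s" "npair (npair 11 0) s"] Y[of s]
      by (subst ev.simps) (cases "nsnd c = 0"; simp; metis npair_nfst_nsnd)
  next
    case 4
    then have "nfst c = 1 \<or> nfst c = 2 \<or> nfst c = 3 \<or> nfst c = 4 \<or> nfst c = 5 \<or> nfst c = 6 \<or> nfst c = 7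
      \<or> nfst c = 8 \<or> nfst c = 9 \<or> 11 < nfst c" by presburger
    then show ?thesis
      by (elim disjE) (subst ev.simps, insert *, simp add: IH Y)+
  qed
qed

text \<open>The true evaluation is itself a valid table, with the least counterexample as Skolem
  witness.\<close>

lemma valid_exists: "\<exists>z. valid z x \<and> (\<forall>p. nfst (z p) = ev y x (nfst p) (nsnd p))"
proof -
  define z where "z p = npair (ev y x (nfst p) (nsnd p)) (LEAST n. ev y x (nsnd (nfst p)) (npair n (nsnd p)) = 0)" for p
  have zl: "nfst (z p) = ev y x (nfst p) (nsnd p)" for p unfolding z_def by simp
  have zr: "ev y x (nsnd (nfst p)) (npair n (nsnd p)) = 0 \<Longrightarrow>
      ev y x (nsnd (nfst p)) (npair (nsnd (z p)) (nsnd p)) = 0" for n p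
    unfolding z_def by simp (rule LeastI)
  have "local_ok x p (z p) q (z q) r (z r)" for p q r
  proof -
    have e: "ev y x (npair 11 0) k = y k" for k by (subst ev.simps) simp
    have v: "ev y x (npair 0 i) k = code_env k i" for i k by (subst ev.simps) simp
    consider "nfst (nfst p) = 0" | "nfst (nfst p) = 10" | "nfst (nfst p) \<noteq> 0" "nfst (nfst p) \<noteq> 10" by blast
    then show ?thesis
    proof cases
      case 1
      then show ?thesis unfolding local_ok_def zl
        by (subst (1 2) ev.simps[of y x "nfst p"]) (auto simp: v gr0_conv_Suc)
    next
      case 2
      have "ev y x (nfst p) (nsnd p) = (if \<forall>n. ev y x (nsnd (nfst p)) (npair n (nsnd p)) \<noteq> 0 then 1 else 0)"
        using 2 by (subst ev.simps) simp
      moreover have "ev y x (nfst q) (nsnd q) \<noteq> 0"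
        if "\<forall>n. ev y x (nsnd (nfst p)) (npair n (nsnd p)) \<noteq> 0" "nfst q = nsnd (nfst p)" "nsnd (nsnd q) = nsnd p"
        using that(1)[rule_format, of "nfst (nsnd q)"] that(2,3) by (metis npair_nfst_nsnd)
      ultimately show ?thesis using 2 zr[of p] unfolding local_ok_def zl by (auto split: if_splits)
    next
      case 3
      then show ?thesis unfolding local_ok_def zl
        by (subst (1 2 3 4 5 6 7 8 9 10 11) ev.simps[of y x "nfst p"]) (auto simp: e)
    qed
  qed
  then have "valid z x" unfolding valid_def by blast
  then show ?thesis using zl by blast
qed

text \<open>Reduces arbitrary arguments to variables, so that the complexity of a relation is
  computed once; one argument may fill several slots.\<close>

lemma arith_apply:
  assumes P: "arith (\<lambda>e F. P (e 0) (e 1) (e 2) (F 0) (F 1))"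
    and E: "afun f" "afun g" "afun h" and G: "areal X" "areal Y"
  shows "arith (\<lambda>e F. P (f e F) (g e F) (h e F) (X e F) (Y e F))"
proof -
  have "arith (\<lambda>e F. (\<lambda>e F. P (e 0) (e 1) (e 2) (F 0) (F 1))
     ((\<lambda>e F (i::nat). if i = 0 then f e F else if i = 1 then g e F else h e F) e F)
     ((\<lambda>e F (i::nat). if i = 0 then X e F else Y e F) e F))"
  proof (rule arith_subst[OF P])
    show "afun (\<lambda>e F. if i = 0 then f e F else if i = 1 then g e F else h e F)" for i :: nat
      by (cases "i = 0"; cases "i = 1") (simp_all add: E)
    show "areal (\<lambda>e F. if i = 0 then X e F else Y e F)" for i :: nat
      by (cases "i = 0") (simp_all add: G)
  qed
  then show ?thesis by simp
qed

lemma sig11_apply: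
  assumes P: "sig11 (\<lambda>e F. P (e 0) (e 1) (e 2) (F 0) (F 1))"
    and E: "afun f" "afun g" "afun h" and G: "areal X" "areal Y"
  shows "sig11 (\<lambda>e F. P (f e F) (g e F) (h e F) (X e F) (Y e F))"
proof -
  have "sig11 (\<lambda>e F. (\<lambda>e F. P (e 0) (e 1) (e 2) (F 0) (F 1))
     ((\<lambda>e F (i::nat). if i = 0 then f e F else if i = 1 then g e F else h e F) e F)
     ((\<lambda>e F (i::nat). if i = 0 then X e F else Y e F) e F))"
  proof (rule sig11_subst[OF P])
    show "afun (\<lambda>e F. if i = 0 then f e F else if i = 1 then g e F else h e F)" for i :: nat
      by (cases "i = 0"; cases "i = 1") (simp_all add: E)
    show "areal (\<lambda>e F. if i = 0 then X e F else Y e F)" for i :: nat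
      by (cases "i = 0") (simp_all add: G)
  qed
  then show ?thesis by simp
qed

lemma pi11_apply:
  assumes "pi11 (\<lambda>e F. P (e 0) (e 1) (e 2) (F 0) (F 1))"
    and "afun f" "afun g" "afun h" "areal X" "areal Y"
  shows "pi11 (\<lambda>e F. P (f e F) (g e F) (h e F) (X e F) (Y e F))"
  unfolding pi11_def
  by (rule sig11_apply[of "\<lambda>a b c x y. \<not> P a b c x y", OF assms(1)[unfolded pi11_def] assms(2-)])

section \<open>Uniformization by comparison of ranks\<close>

text \<open>
  For well-founded relations this says that the rank of \<open>a\<close> in \<open>T\<close> is at most the rank of \<open>b\<close> in \<open>S\<close>.
\<close>

definition sim :: "(nat \<Rightarrow> nat \<Rightarrow> bool) \<Rightarrow> (nat \<Rightarrow> nat \<Rightarrow> bool) \<Rightarrow> nat \<Rightarrow> nat \<Rightarrow> bool" where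
  "sim T S a b \<longleftrightarrow>
    (\<exists>Z. Z a b \<and> (\<forall>a b. Z a b \<longrightarrow> (\<forall>a'. T a' a \<longrightarrow> (\<exists>b'. S b' b \<and> Z a' b'))))"

lemma sim_step: "sim T S a b \<Longrightarrow> T a' a \<Longrightarrow> \<exists>b'. S b' b \<and> sim T S a' b'"
  unfolding sim_def by blast

lemma simI:
  assumes "Z a b" "\<And>a b a'. Z a b \<Longrightarrow> T a' a \<Longrightarrow> \<exists>b'. S b' b \<and> Z a' b'"
  shows "sim T S a b"
  unfolding sim_def using assms by blast

text \<open>\<open>sim\<close> is a greatest fixed point: the right-hand side is itself a
  simulation.\<close>

lemma sim_unfold: "sim T S a b \<longleftrightarrow> (\<forall>a'. T a' a \<longrightarrow> (\<exists>b'. S b' b \<and> sim T S a' b'))"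
proof
  assume "\<forall>a'. T a' a \<longrightarrow> (\<exists>b'. S b' b \<and> sim T S a' b')"
  then show "sim T S a b"
    by (rule simI[where Z = "\<lambda>a b. \<forall>a'. T a' a \<longrightarrow> (\<exists>b'. S b' b \<and> sim T S a' b')"])
      (use sim_step in blast)
qed (use sim_step in blast)

lemma sim_trans: "sim T S a b \<Longrightarrow> sim S R b c \<Longrightarrow> sim T R a c"
proof (rule simI[where Z = "\<lambda>a c. \<exists>b. sim T S a b \<and> sim S R b c"])
  fix a c a' assume "\<exists>b. sim T S a b \<and> sim S R b c" "T a' a"
  then show "\<exists>c'. R c' c \<and> (\<exists>b. sim T S a' b \<and> sim S R b c')"
    using sim_step by meson
qed blast

text \<open>Linear comparability of ranks without ordinals: the negation of the second alternative
  is a simulation, as one unfolding of \<open>sim\<close> shows.\<close>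

lemma sim_total: "sim T S a b \<or> (\<exists>a'. T a' a \<and> sim S T b a')"
proof (rule disjCI)
  assume "\<not> (\<exists>a'. T a' a \<and> sim S T b a')"
  then show "sim T S a b"
  proof (rule simI[where Z = "\<lambda>a b. \<not> (\<exists>a'. T a' a \<and> sim S T b a')"])
    fix a b a' assume "\<not> (\<exists>a'. T a' a \<and> sim S T b a')" "T a' a"
    then have "\<not> sim S T b a'" by blast
    then show "\<exists>b'. S b' b \<and> \<not> (\<exists>a''. T a'' a' \<and> sim S T b' a'')"
      unfolding sim_unfold[of S T b a'] by blast
  qed
qed

lemma sim_accp:
  assumes "Wellfounded.accp S b" "sim T S a b" shows "Wellfounded.accp T a"
  using assms
proof (induction arbitrary: a rule: accp.induct)
  case (accI b)
  show ?case by (rule accp.accI) (use accI sim_step in blast)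
qed

text \<open>
  The root 0 of \<open>T m\<close> has the least rank among all the \<open>T k\<close>, and \<open>m\<close> is the first such index.
\<close>

definition least_wf :: "(nat \<Rightarrow> nat \<Rightarrow> nat \<Rightarrow> bool) \<Rightarrow> nat \<Rightarrow> bool" where
  "least_wf T m \<longleftrightarrow> Wellfounded.accp (T m) 0 \<and> (\<forall>k. k < m \<longrightarrow> \<not> sim (T k) (T m) 0 0) \<and>
     (\<forall>k. m < k \<longrightarrow> (\<forall>a. T m a 0 \<longrightarrow> \<not> sim (T k) (T m) 0 a))"

text \<open>For \<open>m < n\<close>, the first alternative of \<open>sim_total\<close> contradicts
  the minimality of \<open>n\<close>, the second that of \<open>m\<close>.\<close>

lemma least_wf_unique:
  assumes "least_wf T m" "least_wf T n" shows "m = n"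
proof -
  have False if "least_wf T m" "least_wf T n" "m < n" for m n
    using that sim_total[of "T m" "T n" 0 0] unfolding least_wf_def by blast
  with assms show ?thesis by (meson linorder_neqE_nat)
qed

lemma least_wf_exists:
  assumes "Wellfounded.accp (T m) 0" shows "\<exists>m. least_wf T m"
proof -
  \<comment> \<open>Strict comparison of ranks: the root of \<open>T k\<close> is compared with a
    child of the root of \<open>T m\<close>.\<close>
  define lt where "lt k m \<longleftrightarrow> (\<exists>a. T m a 0 \<and> sim (T k) (T m) 0 a)" for k m
  have sim_refl: "sim (T m) (T m) 0 0" by (rule simI[where Z = "(=)"]) blast+
  \<comment> \<open>Induction on an accessible node of one fixed tree replaces induction on
    ordinals: whatever ranks below \<open>T i\<close> is bounded by a child of
    \<open>b\<close>.\<close>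
  have *: "\<exists>m. Wellfounded.accp (T m) 0 \<and> (\<forall>k. \<not> lt k m)" if "Wellfounded.accp (T j) b" "sim (T i) (T j) 0 b" for i j b
    using that
  proof (induction arbitrary: i rule: accp.induct)
    case (accI b)
    show ?case
    proof (cases "\<exists>k. lt k i")
      case True
      then obtain k a where "T i a 0" "sim (T k) (T i) 0 a" unfolding lt_def by blast
      moreover from this sim_step[OF accI.prems] obtain b' where "T j b' b" "sim (T i) (T j) a b'" by blast
      ultimately show ?thesis using accI.IH sim_trans by blast
    next
      case False
      have "Wellfounded.accp (T j) b" using accI.hyps by (rule accp.accI)
      then have "Wellfounded.accp (T i) 0" using accI.prems by (rule sim_accp)
      with False show ?thesis by blast
    qed
  qed
  define M where "M m \<longleftrightarrow> Wellfounded.accp (T m) 0 \<and> (\<forall>k. \<not> lt k m)" for m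
  have "\<exists>m. M m" using *[OF assms sim_refl] unfolding M_def .
  then obtain m where m: "M m" "\<And>k. k < m \<Longrightarrow> \<not> M k" using exists_least_iff[of M] by blast
  have "\<not> sim (T k) (T m) 0 0" if "k < m" for k
  proof
    assume s: "sim (T k) (T m) 0 0"
    then have "Wellfounded.accp (T k) 0" using m(1) sim_accp unfolding M_def by blast
    with m(2)[OF that] obtain l a where "T k a 0" "sim (T l) (T k) 0 a" unfolding M_def lt_def by blast
    moreover from this sim_step[OF s] obtain b where "T m b 0" "sim (T k) (T m) a b" by blast
    ultimately have "lt l m" unfolding lt_def using sim_trans by blast
    with m(1) show False unfolding M_def by blast
  qed
  then have "least_wf T m" using m(1) unfolding least_wf_def M_def lt_def by blast
  then show ?thesis ..
qed

section \<open>Trees of finite approximations\<close>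

text \<open>Goedel's beta function: finite sequences become numbers, decoded arithmetically by
  remainders.\<close>

definition beta :: "nat \<Rightarrow> nat \<Rightarrow> nat" where
  "beta t i = nfst t mod Suc (Suc i * nsnd t)"

lemma beta_exists: "\<exists>t. \<forall>i<n. beta t i = f i"
proof -
  \<comment> \<open>\<open>N\<close> bounds the length and all values, so \<open>fact N\<close> is
    at least every value and a multiple of every difference of distinct indices.\<close>
  define N where "N = n + (\<Sum>i<n. f i)"
  define d :: nat where "d = fact N"
  have fd: "f i < Suc (Suc i * d)" if "i < n" for i
  proof -
    have "f i \<le> (\<Sum>i<n. f i)" using that by (intro member_le_sum) auto
    also have "\<dots> \<le> N" unfolding N_def by simp
    also have "N \<le> d" unfolding d_def by (rule fact_ge_self)
    also have "d \<le> Suc i * d" by simp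
    finally show ?thesis by simp
  qed
  \<comment> \<open>A common divisor is coprime to \<open>d\<close>, hence divides
    \<open>j - i\<close>, hence divides \<open>d\<close>, and so is a unit.\<close>
  have cop: "coprime (Suc (Suc i * d)) (Suc (Suc j * d))" if "i < j" "j < n" for i j
  proof (rule coprimeI)
    fix l assume l: "l dvd Suc (Suc i * d)" "l dvd Suc (Suc j * d)"
    have "coprime l d"
    proof (rule coprimeI)
      fix m assume "m dvd l" "m dvd d"
      then have "m dvd Suc (Suc i * d)" "m dvd Suc i * d" using l(1) dvd_trans by (blast, simp)
      then show "is_unit m" by (metis Suc_eq_plus1 dvd_add_right_iff)
    qed
    have "l dvd Suc (Suc j * d) - Suc (Suc i * d)" using l by (intro dvd_diff_nat)
    also have "Suc (Suc j * d) - Suc (Suc i * d) = (j - i) * d"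
      by (simp add: diff_mult_distrib)
    finally have "l dvd j - i" using \<open>coprime l d\<close> by (simp add: coprime_dvd_mult_left_iff)
    moreover have "j - i dvd d"
      unfolding d_def using that by (intro dvd_fact) (auto simp: N_def)
    ultimately have "l dvd d" by (rule dvd_trans)
    with \<open>coprime l d\<close> show "is_unit l" by (meson coprime_common_divisor dvd_refl)
  qed
  have "\<exists>a. \<forall>i\<in>{..<n}. [a = f i] (mod Suc (Suc i * d))"
  proof (rule chinese_remainder_nat)
    show "\<forall>i\<in>{..<n}. \<forall>j\<in>{..<n}. i \<noteq> j \<longrightarrow> coprime (Suc (Suc i * d)) (Suc (Suc j * d))"
      using cop by (metis coprime_commute lessThan_iff linorder_neqE_nat)
  qed simp
  then obtain a where "\<forall>i\<in>{..<n}. [a = f i] (mod Suc (Suc i * d))" ..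
  then have "\<forall>i<n. beta (npair a d) i = f i"
    using fd unfolding beta_def cong_def by simp
  then show ?thesis ..
qed

text \<open>
  A node \<open>npair n t\<close> stands for the table with entries \<open>beta t i\<close> for \<open>i < n\<close>. The infinite branches
  from the root are the valid tables in which the entry at \<open>g\<close> is nonzero.
\<close>

definition node_ok :: "nat \<Rightarrow> baire \<Rightarrow> nat \<Rightarrow> nat \<Rightarrow> bool" where
  "node_ok g x n t \<longleftrightarrow>
    (\<forall>p q r. p < n \<and> q < n \<and> r < n \<longrightarrow> local_ok x p (beta t p) q (beta t q) r (beta t r)) \<and>
    (g < n \<longrightarrow> nfst (beta t g) \<noteq> 0)"

text \<open>The longer node comes first, so that accessibility excludes infinite branches. Codes
  \<open>t\<close> are not unique; extension compares decoded entries.\<close>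

definition approx :: "nat \<Rightarrow> baire \<Rightarrow> nat \<Rightarrow> nat \<Rightarrow> bool" where
  "approx g x a b \<longleftrightarrow> nfst a = Suc (nfst b) \<and> (\<forall>i. i < nfst b \<longrightarrow> beta (nsnd a) i = beta (nsnd b) i) \<and>
     node_ok g x (nfst a) (nsnd a)"

text \<open>The normal form of Pi-1-1 statements. The root 0 is the empty table, and an infinite
  branch amounts to a \<open>y\<close> together with a table showing that the formula holds at
  \<open>y\<close>.\<close>

lemma accp_approx: "Wellfounded.accp (approx g x) 0 \<longleftrightarrow> (\<forall>y. ev y x (nfst g) (nsnd g) = 0)"
proof
  assume acc: "Wellfounded.accp (approx g x) 0"
  show "\<forall>y. ev y x (nfst g) (nsnd g) = 0"
  proof (rule ccontr)
    assume "\<not> (\<forall>y. ev y x (nfst g) (nsnd g) = 0)"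
    then obtain y where y: "ev y x (nfst g) (nsnd g) \<noteq> 0" by blast
    obtain z where z: "valid z x" "\<And>p. nfst (z p) = ev y x (nfst p) (nsnd p)"
      using valid_exists[of x y] by blast
    \<comment> \<open>Every node that agrees with \<open>z\<close> has a child that agrees with
      \<open>z\<close>, which accessibility forbids.\<close>
    have False if "Wellfounded.accp (approx g x) a" "\<forall>i<nfst a. beta (nsnd a) i = z i" for a
      using that
    proof (induction rule: accp.induct)
      case (accI a)
      obtain t where t: "\<forall>i<Suc (nfst a). beta t i = z i" using beta_exists by blast
      have "node_ok g x (Suc (nfst a)) t"
        unfolding node_ok_def
      proof (intro conjI allI impI)
        fix p q r assume "p < Suc (nfst a) \<and> q < Suc (nfst a) \<and> r < Suc (nfst a)"
        then have "beta t p = z p" "beta t q = z q" "beta t r = z r" using t by blast+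
        then show "local_ok x p (beta t p) q (beta t q) r (beta t r)" using z(1) by (simp only: valid_def)
      next
        assume "g < Suc (nfst a)"
        then have "beta t g = z g" using t by blast
        then show "nfst (beta t g) \<noteq> 0" using y by (simp only: z(2) not_False_eq_True)
      qed
      then have "approx g x (npair (Suc (nfst a)) t) a" using t accI.prems unfolding approx_def by simp
      then show False using accI.IH[of "npair (Suc (nfst a)) t"] t by simp
    qed
    from this[OF acc] show False by simp
  qed
next
  assume 0: "\<forall>y. ev y x (nfst g) (nsnd g) = 0"
  show "Wellfounded.accp (approx g x) 0"
  proof (rule ccontr)
    assume "\<not> Wellfounded.accp (approx g x) 0"
    then have "\<exists>f. \<forall>n. (\<not> Wellfounded.accp (approx g x) (f n) \<and> (n = 0 \<longrightarrow> f n = 0)) \<and> approx g x (f (Suc n)) (f n)"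
    proof (intro dependent_nat_choice)
      fix a n :: nat assume "\<not> Wellfounded.accp (approx g x) a \<and> (n = 0 \<longrightarrow> a = 0)"
      then have "\<not> Wellfounded.accp (approx g x) a" by blast
      then obtain b where "approx g x b a" "\<not> Wellfounded.accp (approx g x) b" by (rule not_accp_down)
      then show "\<exists>b. (\<not> Wellfounded.accp (approx g x) b \<and> (Suc n = 0 \<longrightarrow> b = 0)) \<and> approx g x b a" by blast
    qed blast
    then obtain f where f: "f 0 = 0" "\<And>n. approx g x (f (Suc n)) (f n)" by blast
    have lev: "nfst (f n) = n" for n
      by (induction n) (use f in \<open>auto simp: approx_def\<close>)
    \<comment> \<open>The limit of the branch: entry \<open>i\<close> is fixed from level
      \<open>i + 1\<close> on.\<close>
    define z where "z i = beta (nsnd (f (Suc i))) i" for i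
    have z: "beta (nsnd (f n)) i = z i" if "i < n" for n i
      using that
    proof (induction n)
      case (Suc n)
      show ?case
      proof (cases "i = n")
        case False
        with Suc.prems have "i < n" by simp
        then show ?thesis using Suc.IH f(2)[of n] lev[of n] unfolding approx_def by simp
      qed (simp add: z_def)
    qed simp
    have ok: "node_ok g x (Suc n) (nsnd (f (Suc n)))" for n
      using f(2)[of n] lev[of "Suc n"] unfolding approx_def by simp
    have "local_ok x p (z p) q (z q) r (z r)" for p q r
    proof -
      have "p < Suc (p + q + r)" "q < Suc (p + q + r)" "r < Suc (p + q + r)" by auto
      with ok[of "p + q + r"] show ?thesis unfolding node_ok_def by (simp add: z)
    qed
    then have "valid z x" unfolding valid_def by blast
    \<comment> \<open>\<open>refl\<close> lets the entries of tag 11 define the function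
      \<open>y\<close> that this table evaluates.\<close>
    from valid_imp_ev[OF this refl, of "nfst g" "nsnd g"]
    have "nfst (z g) = ev (\<lambda>k. nfst (z (npair (npair 11 0) k))) x (nfst g) (nsnd g)" by simp
    also have "\<dots> = 0" using 0 by blast
    finally have "nfst (z g) = 0" .
    moreover have "nfst (z g) \<noteq> 0" using ok[of g] z[of g "Suc g"] unfolding node_ok_def by simp
    ultimately show False by simp
  qed
qed

section \<open>Complexity of evaluation and of rank comparison\<close>

lemma arith_valid: "arith (\<lambda>e F. valid (F i) (F j))"
  unfolding valid_def local_ok_def by (intro arith_intros afun_intros)

lemma valid_exists_Y:
  obtains z where "valid z x" "\<And>k. nfst (z (npair (npair 11 0) k)) = y k"
proof -
  obtain z where z: "valid z x" "\<And>p. nfst (z p) = ev y x (nfst p) (nsnd p)"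
    using valid_exists[of x y] by blast
  have "nfst (z (npair (npair 11 0) k)) = y k" for k
    unfolding z(2) by (subst ev.simps) simp
  with z(1) show thesis by (rule that)
qed

text \<open>Suitable tables exist and all agree, so evaluation has this existential form and the
  universal form \<open>ev_nonzero_iff_all\<close>; it is Delta-1-1 uniformly in the code.\<close>

lemma ev_nonzero_iff_ex:
  "ev y x c s \<noteq> 0 \<longleftrightarrow> (\<exists>z. valid z x \<and> (\<forall>k. nfst (z (npair (npair 11 0) k)) = y k) \<and> nfst (z (npair c s)) \<noteq> 0)"
proof
  assume *: "ev y x c s \<noteq> 0"
  obtain z where z: "valid z x" "\<And>k. nfst (z (npair (npair 11 0) k)) = y k" using valid_exists_Y[of x y] by blast
  have "nfst (z (npair c s)) \<noteq> 0" unfolding valid_imp_ev[OF z] by (rule *)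
  with z show "\<exists>z. valid z x \<and> (\<forall>k. nfst (z (npair (npair 11 0) k)) = y k) \<and> nfst (z (npair c s)) \<noteq> 0" by blast
next
  assume "\<exists>z. valid z x \<and> (\<forall>k. nfst (z (npair (npair 11 0) k)) = y k) \<and> nfst (z (npair c s)) \<noteq> 0"
  then obtain z where z: "valid z x" "\<And>k. nfst (z (npair (npair 11 0) k)) = y k" "nfst (z (npair c s)) \<noteq> 0" by blast
  from z(3) show "ev y x c s \<noteq> 0" unfolding valid_imp_ev[OF z(1,2)] .
qed

lemma ev_nonzero_iff_all:
  "ev y x c s \<noteq> 0 \<longleftrightarrow> (\<forall>z. valid z x \<and> (\<forall>k. nfst (z (npair (npair 11 0) k)) = y k) \<longrightarrow> nfst (z (npair c s)) \<noteq> 0)"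
proof
  assume *: "ev y x c s \<noteq> 0"
  show "\<forall>z. valid z x \<and> (\<forall>k. nfst (z (npair (npair 11 0) k)) = y k) \<longrightarrow> nfst (z (npair c s)) \<noteq> 0"
  proof (intro allI impI, elim conjE)
    fix z assume z: "valid z x" "\<forall>k. nfst (z (npair (npair 11 0) k)) = y k"
    show "nfst (z (npair c s)) \<noteq> 0" unfolding valid_imp_ev[OF z(1) spec[OF z(2)]] by (rule *)
  qed
next
  assume *: "\<forall>z. valid z x \<and> (\<forall>k. nfst (z (npair (npair 11 0) k)) = y k) \<longrightarrow> nfst (z (npair c s)) \<noteq> 0"
  obtain z where z: "valid z x" "\<And>k. nfst (z (npair (npair 11 0) k)) = y k" using valid_exists_Y[of x y] by blast
  with * have "nfst (z (npair c s)) \<noteq> 0" by blast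
  then show "ev y x c s \<noteq> 0" unfolding valid_imp_ev[OF z] .
qed

lemma sig11_ev:
  assumes "afun c" "afun s" "areal Y" "areal X"
  shows "sig11 (\<lambda>e F. ev (Y e F) (X e F) (c e F) (s e F) \<noteq> 0)"
  by (rule sig11_apply[where P = "\<lambda>c s _ y x. ev y x c s \<noteq> 0", OF _ assms(1,2,2,3,4)],
      unfold ev_nonzero_iff_ex, rule sig11_exr, rule sig11_arith)
    (intro arith_conj arith_valid arith_intros afun_intros)

lemma pi11_ev:
  assumes "afun c" "afun s" "areal Y" "areal X"
  shows "pi11 (\<lambda>e F. ev (Y e F) (X e F) (c e F) (s e F) \<noteq> 0)"
  by (rule pi11_apply[where P = "\<lambda>c s _ y x. ev y x c s \<noteq> 0", OF _ assms(1,2,2,3,4)],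
      unfold ev_nonzero_iff_all, rule pi11_allr, rule pi11_arith)
    (intro arith_conj arith_imp arith_valid arith_intros afun_intros)

lemma arith_approx:
  assumes "afun g" "areal X" "afun a" "afun b"
  shows "arith (\<lambda>e F. approx (g e F) (X e F) (a e F) (b e F))"
  by (rule arith_apply[where P = "\<lambda>g a b x _. approx g x a b", OF _ assms(1,3,4,2,2)],
     unfold approx_def node_ok_def beta_def local_ok_def)
    (intro arith_intros afun_intros)

text \<open>A simulation between numbers is coded as the support of a function, which leaves one
  existential function quantifier.\<close>

lemma sim_iff_real:
  "sim T S a b \<longleftrightarrow> (\<exists>z::baire. z (npair a b) \<noteq> 0 \<and> (\<forall>a b. z (npair a b) \<noteq> 0 \<longrightarrow>
     (\<forall>a'. T a' a \<longrightarrow> (\<exists>b'. S b' b \<and> z (npair a' b') \<noteq> 0))))"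
proof
  assume "sim T S a b"
  then obtain Z where "Z a b" "\<forall>a b. Z a b \<longrightarrow> (\<forall>a'. T a' a \<longrightarrow> (\<exists>b'. S b' b \<and> Z a' b'))"
    unfolding sim_def by blast
  moreover define z :: baire where "z p = (if Z (nfst p) (nsnd p) then 1 else 0)" for p
  have "z (npair a b) \<noteq> 0 \<longleftrightarrow> Z a b" for a b unfolding z_def by simp
  ultimately show "\<exists>z::baire. z (npair a b) \<noteq> 0 \<and> (\<forall>a b. z (npair a b) \<noteq> 0 \<longrightarrow>
     (\<forall>a'. T a' a \<longrightarrow> (\<exists>b'. S b' b \<and> z (npair a' b') \<noteq> 0)))"
    by (intro exI[of _ z]) simp
next
  assume "\<exists>z::baire. z (npair a b) \<noteq> 0 \<and> (\<forall>a b. z (npair a b) \<noteq> 0 \<longrightarrow>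
     (\<forall>a'. T a' a \<longrightarrow> (\<exists>b'. S b' b \<and> z (npair a' b') \<noteq> 0)))"
  then obtain z :: baire where "z (npair a b) \<noteq> 0"
    "\<forall>a b. z (npair a b) \<noteq> 0 \<longrightarrow> (\<forall>a'. T a' a \<longrightarrow> (\<exists>b'. S b' b \<and> z (npair a' b') \<noteq> 0))" by blast
  then show "sim T S a b" by (intro simI[where Z = "\<lambda>a b. z (npair a b) \<noteq> 0"]) blast+
qed

lemma sig11_sim:
  assumes "afun g" "afun h" "areal X" "afun b"
  shows "sig11 (\<lambda>e F. sim (approx (g e F) (X e F)) (approx (h e F) (X e F)) 0 (b e F))"
  by (rule sig11_apply[where P = "\<lambda>g h b x _. sim (approx g x) (approx h x) 0 b", OF _ assms(1,2,4,3,3)],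
     unfold sim_iff_real, rule sig11_exr, rule sig11_arith)
    (intro arith_approx arith_intros afun_intros)

text \<open>
  Uniformizes the universal relation in \<open>m\<close>; every hyperarithmetical function \<open>f\<close> has an index \<open>b\<close>
  for which this is the graph of \<open>f\<close>.
\<close>

definition hyp_graph :: "nat \<Rightarrow> nat \<Rightarrow> nat \<Rightarrow> baire \<Rightarrow> bool" where
  "hyp_graph b k m x \<longleftrightarrow> least_wf (\<lambda>m. approx (npair b (npair k (npair m 0))) x) m"

lemma hyp_graph_unique: "hyp_graph b k m x \<Longrightarrow> hyp_graph b k n x \<Longrightarrow> m = n"
  unfolding hyp_graph_def by (rule least_wf_unique)

lemma hyp_graph_imp: "hyp_graph b k m x \<Longrightarrow> ev y x b (npair k (npair m 0)) = 0"
  unfolding hyp_graph_def least_wf_def accp_approx by simp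

lemma hyp_graph_exists: "(\<And>y. ev y x b (npair k (npair m 0)) = 0) \<Longrightarrow> \<exists>m. hyp_graph b k m x"
  unfolding hyp_graph_def by (rule least_wf_exists[of _ m]) (simp add: accp_approx)

text \<open>Both rank comparisons in \<open>least_wf\<close> are negated, and
  \<open>accp_approx\<close> turns accessibility into a quantifier over all
  \<open>y\<close>.\<close>

lemma pi11_hyp_graph:
  assumes "afun b" "afun k" "afun m" "areal X"
  shows "pi11 (\<lambda>e F. hyp_graph (b e F) (k e F) (m e F) (X e F))"
proof (rule pi11_apply[where P = "\<lambda>b k m x _. hyp_graph b k m x", OF _ assms assms(4)])
  have "pi11 (\<lambda>e F. (\<forall>y. \<not> (ev y (F 0) (e 0) (npair (e 1) (npair (e 2) 0)) \<noteq> 0)) \<and>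
    (\<forall>k. k < e 2 \<longrightarrow> \<not> sim (approx (npair (e 0) (npair (e 1) (npair k 0))) (F 0)) (approx (npair (e 0) (npair (e 1) (npair (e 2) 0))) (F 0)) 0 0) \<and>
    (\<forall>k. e 2 < k \<longrightarrow> (\<forall>a. approx (npair (e 0) (npair (e 1) (npair (e 2) 0))) (F 0) a 0 \<longrightarrow>
       \<not> sim (approx (npair (e 0) (npair (e 1) (npair k 0))) (F 0)) (approx (npair (e 0) (npair (e 1) (npair (e 2) 0))) (F 0)) 0 a)))"
    by (intro pi11_conj pi11_alln pi11_allr pi11_not pi11_imp sig11_sim sig11_ev
        sig11_arith[OF arith_less] sig11_arith[OF arith_approx] afun_intros)
  then show "pi11 (\<lambda>e F. hyp_graph (e 0) (e 1) (e 2) (F 0))"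
    unfolding hyp_graph_def least_wf_def accp_approx by simp
qed

section \<open>Indices of hyperarithmetical functions\<close>

lemma sig11_code:
  assumes "sig11 P"
  obtains b where "\<And>k m x. P (nenv [k, m]) (fenv [x]) \<longleftrightarrow> (\<exists>y. ev y x b (npair k (npair m 0)) \<noteq> 0)"
proof -
  obtain Q where Q: "arith Q" "\<And>e F. P e F \<longleftrightarrow> (\<exists>y. Q e (case_nat y F))"
    using sig11E[OF assms] by blast
  obtain b where b: "\<And>y x s. ev y x b s \<noteq> 0 \<longleftrightarrow> Q (code_env s) (fenv [y, x])"
    using arith_code[OF Q(1)] by blast
  show ?thesis
  proof (rule that)
    show "P (nenv [k, m]) (fenv [x]) \<longleftrightarrow> (\<exists>y. ev y x b (npair k (npair m 0)) \<noteq> 0)" for k m x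
      unfolding Q(2) b code_env_npair code_env_0 nenv_Cons nenv_Nil fenv_Cons[of _ "[x]"] ..
  qed
qed

lemma Hyp_fun_graph:
  assumes "Hyp_fun f"
  shows "sig11 (\<lambda>e F. f (F 0) = F 1)" "pi11 (\<lambda>e F. f (F 0) = F 1)"
proof -
  \<comment> \<open>Taking \<open>R\<close> to be the identity or negation treats the graph and its
    complement at once.\<close>
  have *: "sig11 (\<lambda>e F. R (f (F 0) = F 1))"
    if S: "Sigma11 0 2 (\<lambda>ns xs. R (f (xs ! 0) = xs ! 1))" for R :: "bool \<Rightarrow> bool"
  proof -
    obtain P where P: "sig11 P" "\<And>ns xs. length ns = 0 \<Longrightarrow> length xs = 2 \<Longrightarrow>
        R (f (xs ! 0) = xs ! 1) \<longleftrightarrow> P (nenv ns) (fenv xs)"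
      using S unfolding Sigma11_iff by blast
    have "sig11 (\<lambda>e F. P ((\<lambda>e F. nenv []) e F) ((\<lambda>e F. fenv [F 0, F 1]) e F))"
    proof (rule sig11_subst[OF P(1)])
      show "areal (\<lambda>e F. fenv [F 0, F 1] i)" for i
        by (cases "i = 0"; cases "i = 1") (simp_all add: fenv_2 afun_app afun_var afun_const)
    qed (simp add: nenv_Nil afun_const)
    moreover have "R (f x = y) \<longleftrightarrow> P (nenv []) (fenv [x, y])" for x y
      using P(2)[of "[]" "[x, y]"] by simp
    ultimately show ?thesis by (simp only:)
  qed
  show "sig11 (\<lambda>e F. f (F 0) = F 1)" "pi11 (\<lambda>e F. f (F 0) = F 1)"
    using assms *[of "\<lambda>b. b"] *[of Not]
    unfolding Hyp_fun_def Hyp_rel_def Delta11_def Pi11_def pi11_def by simp_all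
qed

lemma Hyp_relI:
  assumes "sig11 (\<lambda>e F. (F 0, F 1) \<in> R)" "pi11 (\<lambda>e F. (F 0, F 1) \<in> R)"
  shows "Hyp_rel R"
  unfolding Hyp_rel_def by (rule Delta11I[OF assms]) (simp add: fenv_def)

lemma Hyp_funI:
  assumes "sig11 (\<lambda>e F. f (F 0) = F 1)" "pi11 (\<lambda>e F. f (F 0) = F 1)"
  shows "Hyp_fun f"
  unfolding Hyp_fun_def by (rule Hyp_relI) (simp_all only: mem_Collect_eq prod.case assms)

text \<open>A Sigma-1-1 definition of \<open>f x k \<noteq> m\<close> supplies the code
  \<open>b\<close>. The relation to be uniformized is then already single-valued, so uniformization
  returns \<open>f\<close> itself.\<close>

lemma Hyp_fun_index:
  assumes "Hyp_fun f"
  obtains b where "\<And>k m x. hyp_graph b k m x \<longleftrightarrow> f x k = m"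
proof -
  have "sig11 (\<lambda>e F. \<exists>y. f (F 0) = y \<and> y (e 0) \<noteq> e 1)"
  proof (rule sig11_exr, rule sig11_conj)
    show "sig11 (\<lambda>e F. f (F (Suc 0)) = F 0)"
      using sig11_apply[where P = "\<lambda>_ _ _ x y. f x = y" and X = "\<lambda>e F. F (Suc 0)" and Y = "\<lambda>e F. F 0",
          OF Hyp_fun_graph(1)[OF assms] afun_const afun_const afun_const]
      by (simp add: afun_app afun_var)
    show "sig11 (\<lambda>e F. F 0 (e 0) \<noteq> e 1)"
      by (intro sig11_arith arith_intros afun_intros)
  qed
  then obtain b where b: "\<And>k m x. (\<exists>y. f (fenv [x] 0) = y \<and> y (nenv [k, m] 0) \<noteq> nenv [k, m] 1)
      \<longleftrightarrow> (\<exists>y. ev y x b (npair k (npair m 0)) \<noteq> 0)"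
    by (rule sig11_code) blast
  have nf: "f x k \<noteq> m \<longleftrightarrow> (\<exists>y. ev y x b (npair k (npair m 0)) \<noteq> 0)" for k m x
    using b[of x k m] by (simp add: fenv_def nenv_def)
  have b: "f x k = m \<longleftrightarrow> (\<forall>y. ev y x b (npair k (npair m 0)) = 0)" for k m x
    using nf[of x k m] by auto
  show ?thesis
  proof (rule that)
    fix k m x
    have 1: "f x k = m" if "hyp_graph b k m x" for m unfolding b using hyp_graph_imp[OF that] by blast
    obtain m' where m': "hyp_graph b k m' x" using hyp_graph_exists[of x b k "f x k"] b by blast
    show "hyp_graph b k m x \<longleftrightarrow> f x k = m" using 1 m' by blast
  qed
qed

section \<open>An independent family\<close>

text \<open>The formula \<open>s\<close> is applied to its own code.\<close>

definition diag :: "nat \<Rightarrow> nat \<Rightarrow> baire \<Rightarrow> bool" where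
  "diag s m z \<longleftrightarrow> ev z (\<lambda>_. 0) s (npair s (npair m 0)) \<noteq> 0"

text \<open>The first value of \<open>y\<close> names the summand. Index 0 is left out because
  \<open>j = 0\<close> will stand for the whole space.\<close>

definition in_other :: "nat \<Rightarrow> nat \<Rightarrow> baire \<Rightarrow> bool" where
  "in_other s j y \<longleftrightarrow> y 0 \<noteq> j \<and> y 0 \<noteq> 0 \<and> diag s (y 0) (\<lambda>k. y (Suc k))"

lemma sig11_diag:
  assumes "afun s" "afun m" "areal Z" shows "sig11 (\<lambda>e F. diag (s e F) (m e F) (Z e F))"
  unfolding diag_def by (intro sig11_ev afun_intros assms)

lemma pi11_diag:
  assumes "afun s" "afun m" "areal Z" shows "pi11 (\<lambda>e F. diag (s e F) (m e F) (Z e F))"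
  unfolding diag_def by (intro pi11_ev afun_intros assms)

text \<open>
  The second conjunct says that the function with index \<open>nsnd v\<close> maps \<open>x\<close> into \<open>in_other s (nfst v)\<close>;
  it is phrased so that the graph occurs only positively.
\<close>

definition reduces :: "nat \<Rightarrow> nat \<Rightarrow> bool" where
  "reduces s v \<longleftrightarrow> (\<forall>x. nfst v = 0 \<or> diag s (nfst v) x \<longrightarrow>
     (\<forall>k. \<exists>m. hyp_graph (nsnd v) k m x) \<and>
     (\<forall>y. (\<exists>k m. m \<noteq> y k \<and> hyp_graph (nsnd v) k m x) \<or> in_other s (nfst v) y))"

text \<open>\<open>diag\<close> occurs in the premise and in the conclusion, which calls for its
  Sigma-1-1 and its Pi-1-1 form respectively.\<close>

lemma pi11_reduces: "pi11 (\<lambda>e F. reduces (e 0) (e 1))"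
  unfolding reduces_def in_other_def
  by (intro pi11_allr pi11_imp sig11_disj sig11_arith[OF arith_eq] sig11_diag pi11_conj pi11_alln
      pi11_exn pi11_hyp_graph pi11_disj pi11_arith[OF arith_not[OF arith_eq]] pi11_diag afun_intros)

text \<open>The case \<open>j = 0\<close> prevents a reduction from sending the complement of one
  sum into another sum; the other cases separate the summands.\<close>

lemma independent_family:
  "\<exists>s. \<forall>f j. Hyp_fun f \<longrightarrow> (\<exists>x. (j = 0 \<or> diag s j x) \<and> \<not> in_other s j (f x))"
proof (rule ccontr)
  assume contr: "\<not> ?thesis"
  have ex: "\<exists>v. reduces s v" for s
  proof -
    obtain f j where f: "Hyp_fun f" "\<And>x. j = 0 \<or> diag s j x \<Longrightarrow> in_other s j (f x)"
      using contr by blast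
    obtain b where b: "\<And>k m x. hyp_graph b k m x \<longleftrightarrow> f x k = m" using Hyp_fun_index[OF f(1)] by blast
    have "reduces s (npair j b)"
      unfolding reduces_def nfst_npair nsnd_npair b
    proof (intro allI impI conjI)
      fix x y assume x: "j = 0 \<or> diag s j x"
      show "(\<exists>k m. m \<noteq> y k \<and> f x k = m) \<or> in_other s j y"
      proof (cases "y = f x")
        case True
        then show ?thesis using f(2)[OF x] by simp
      next
        case False
        then show ?thesis by (metis ext)
      qed
    qed blast
    then show ?thesis ..
  qed
  obtain r where "\<And>s v x. \<not> reduces (nenv [s, v] 0) (nenv [s, v] 1) \<longleftrightarrow>
      (\<exists>y. ev y x r (npair s (npair v 0)) \<noteq> 0)"
    using sig11_code[OF sig11_not[OF pi11_reduces]] by blast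
  then have nr: "\<not> reduces s v \<longleftrightarrow> (\<exists>y. ev y (\<lambda>_. 0) r (npair s (npair v 0)) \<noteq> 0)" for s v
    by (simp add: nenv_def)
  have r: "reduces s v \<longleftrightarrow> (\<forall>y. ev y (\<lambda>_. 0) r (npair s (npair v 0)) = 0)" for s v
    using nr[of s v] by auto
  define V where "V s v \<longleftrightarrow> hyp_graph r s v (\<lambda>_. 0)" for s v
  have V_ex: "\<exists>v. V s v" for s
    unfolding V_def using ex[of s] r hyp_graph_exists by blast
  have V_un: "V s v \<Longrightarrow> V s w \<Longrightarrow> v = w" for s v w
    unfolding V_def by (rule hyp_graph_unique)
  have V_red: "V s v \<Longrightarrow> reduces s v" for s v
    unfolding V_def r using hyp_graph_imp by blast
  \<comment> \<open>A total function with a Pi-1-1 graph also has a Sigma-1-1 graph: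
    \<open>v\<close> is the value iff no other number is.\<close>
  have "sig11 (\<lambda>e F. \<forall>w. w \<noteq> e 1 \<longrightarrow> \<not> V (e 0) w)"
    unfolding V_def
    by (intro sig11_alln sig11_imp sig11_not pi11_hyp_graph pi11_arith[OF arith_not[OF arith_eq]] afun_intros)
  moreover have "(\<forall>w. w \<noteq> v \<longrightarrow> \<not> V s w) \<longleftrightarrow> V s v" for s v
    using V_ex[of s] V_un by metis
  ultimately have "sig11 (\<lambda>e F. V (e 0) (e 1))" by simp
  then obtain Q where Q: "arith Q" "\<And>e F. V (e 0) (e 1) \<longleftrightarrow> (\<exists>y. Q e (case_nat y F))"
    using sig11E by blast
  \<comment> \<open>The selector \<open>V\<close> is refuted by the formula whose \<open>m\<close>-th set consists of the witnesses that
    \<open>V\<close> chose a reduction of the \<open>m\<close>-th set: exactly that set is then nonempty.\<close>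
  have "arith (\<lambda>e F. \<exists>b. Q (nenv [e 0, npair (e 1) b]) (fenv [F 0]))"
  proof (rule arith_ex, rule arith_subst[OF Q(1)])
    show "afun (\<lambda>e F. nenv [e (Suc 0), npair (e (Suc 1)) (e 0)] i)" for i
      by (cases "i = 0"; cases "i = 1")
        (simp_all add: nenv_def afun_var afun_const afun_npair)
    show "areal (\<lambda>e F. fenv [F 0] i)" for i
      by (cases "i = 0") (simp_all add: fenv_def afun_app afun_var afun_const)
  qed
  then obtain c where c: "\<And>y x s. ev y x c s \<noteq> 0 \<longleftrightarrow>
      (\<exists>b. Q (nenv [code_env s 0, npair (code_env s 1) b]) (fenv [fenv [y, x] 0]))"
    using arith_code by blast
  have diag_c: "diag c m z \<longleftrightarrow> (\<exists>b. Q (nenv [c, npair m b]) (case_nat z (fenv [])))" for m z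
    unfolding diag_def c by (simp add: code_env_npair fenv_2 fenv_Cons)
  \<comment> \<open>The witness in the Sigma-1-1 form of \<open>V\<close> is the very member
    \<open>z\<close>, so nonemptiness expresses the selection.\<close>
  have ne: "(\<exists>z. diag c m z) \<longleftrightarrow> (\<exists>b. V c (npair m b))" for m
    using Q(2)[of "nenv [c, npair m _]" "fenv []"] unfolding diag_c by (auto simp: nenv_def)
  obtain v where v: "V c v" using V_ex by blast
  then obtain x where x: "diag c (nfst v) x" using ne[of "nfst v"] by (metis npair_nfst_nsnd)
  then obtain y where y: "\<And>k. hyp_graph (nsnd v) k (y k) x"
    using V_red[OF v] unfolding reduces_def by metis
  then have "\<not> (\<exists>k m. m \<noteq> y k \<and> hyp_graph (nsnd v) k m x)" using hyp_graph_unique by blast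
  then have "in_other c (nfst v) y" using V_red[OF v] x unfolding reduces_def by blast
  \<comment> \<open>The image \<open>y\<close> exhibits a member of a second set, hence a second
    value selected at \<open>c\<close>.\<close>
  then obtain b where "V c (npair (y 0) b)" "y 0 \<noteq> nfst v" using ne unfolding in_other_def by blast
  with V_un[OF v] show False by (metis nfst_npair)
qed

section \<open>The embedding\<close>

lemma Hyp_nat_set_mem:
  assumes "Hyp_nat_set X" "afun f"
  shows "sig11 (\<lambda>e F. f e F \<in> X)" "pi11 (\<lambda>e F. f e F \<in> X)"
proof -
  have *: "sig11 (\<lambda>e F. R (f e F \<in> X))"
    if S: "Sigma11 1 0 (\<lambda>ns xs. R (ns ! 0 \<in> X))" for R :: "bool \<Rightarrow> bool"
  proof -
    obtain P where P: "sig11 P" "\<And>ns xs. length ns = 1 \<Longrightarrow> length xs = 0 \<Longrightarrow>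
        R (ns ! 0 \<in> X) \<longleftrightarrow> P (nenv ns) (fenv xs)"
      using S unfolding Sigma11_iff by blast
    have "sig11 (\<lambda>e F. P ((\<lambda>e F. nenv [f e F]) e F) ((\<lambda>e F. fenv []) e F))"
    proof (rule sig11_subst[OF P(1)])
      show "afun (\<lambda>e F. nenv [f e F] i)" for i
        by (cases "i = 0") (simp_all add: nenv_def assms(2) afun_const)
    qed (simp add: fenv_Nil afun_const)
    moreover have "R (n \<in> X) \<longleftrightarrow> P (nenv [n]) (fenv [])" for n
      using P(2)[of "[n]" "[]"] by simp
    ultimately show ?thesis by simp
  qed
  show "sig11 (\<lambda>e F. f e F \<in> X)" "pi11 (\<lambda>e F. f e F \<in> X)"
    using assms(1) *[of "\<lambda>b. b"] *[of Not]
    unfolding Hyp_nat_set_def Delta11_def Pi11_def pi11_def by simp_all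
qed

lemma Hyp_fun_if:
  assumes S: "sig11 (\<lambda>e F. F 0 \<in> S)" "pi11 (\<lambda>e F. F 0 \<in> S)"
    and G: "areal (\<lambda>e F. G (F 0))" and H: "areal (\<lambda>e F. H (F 0))"
  shows "Hyp_fun (\<lambda>x. if x \<in> S then G x else H x)"
proof (rule Hyp_funI)
  have eq: "(if x \<in> S then G x else H x) = y \<longleftrightarrow>
      (x \<in> S \<longrightarrow> (\<forall>k. G x k = y k)) \<and> (x \<notin> S \<longrightarrow> (\<forall>k. H x k = y k))" for x y
    by (auto simp: fun_eq_iff)
  have a: "arith (\<lambda>e F. \<forall>k. G (F 0) k = F 1 k)" "arith (\<lambda>e F. \<forall>k. H (F 0) k = F 1 k)"
    by (intro arith_all arith_eq G H afun_app afun_var)+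
  show "sig11 (\<lambda>e F. (if F 0 \<in> S then G (F 0) else H (F 0)) = F 1)"
    unfolding eq by (intro sig11_conj sig11_imp pi11_not S sig11_arith a)
  show "pi11 (\<lambda>e F. (if F 0 \<in> S then G (F 0) else H (F 0)) = F 1)"
    unfolding eq by (intro pi11_conj pi11_imp sig11_not S pi11_arith a)
qed

lemma Hyp_fun_comp:
  assumes f: "Hyp_fun f" and h: "areal (\<lambda>e F. h (F 0))"
  shows "Hyp_fun (\<lambda>x. f (h x))"
proof (rule Hyp_funI)
  show "sig11 (\<lambda>e F. f (h (F 0)) = F 1)"
    by (rule sig11_apply[where P = "\<lambda>_ _ _ x y. f x = y" and X = "\<lambda>e F. h (F 0)" and Y = "\<lambda>e F. F 1",
          OF Hyp_fun_graph(1)[OF f] afun_const afun_const afun_const h afun_app[OF afun_var]])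
  show "pi11 (\<lambda>e F. f (h (F 0)) = F 1)"
    by (rule pi11_apply[where P = "\<lambda>_ _ _ x y. f x = y" and X = "\<lambda>e F. h (F 0)" and Y = "\<lambda>e F. F 1",
          OF Hyp_fun_graph(2)[OF f] afun_const afun_const afun_const h afun_app[OF afun_var]])
qed

text \<open>Element \<open>n\<close> of \<open>X\<close> contributes the set of index
  \<open>n + 1\<close>, as index 0 is reserved.\<close>

definition dsum :: "nat \<Rightarrow> nat set \<Rightarrow> baire set" where
  "dsum s X = {x. x 0 \<noteq> 0 \<and> x 0 - 1 \<in> X \<and> diag s (x 0) (\<lambda>k. x (Suc k))}"

lemma dsum_mem:
  assumes "Hyp_nat_set X"
  shows "sig11 (\<lambda>e F. F i \<in> dsum s X)" "pi11 (\<lambda>e F. F i \<in> dsum s X)"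
  unfolding dsum_def mem_Collect_eq
  by (intro sig11_conj sig11_arith[OF arith_not[OF arith_eq]] Hyp_nat_set_mem[OF assms] sig11_diag
      afun_intros,
    intro pi11_conj pi11_arith[OF arith_not[OF arith_eq]] Hyp_nat_set_mem[OF assms] pi11_diag
      afun_intros)

definition two_classes :: "baire set \<Rightarrow> (baire \<times> baire) set" where
  "two_classes S = {(x, y). x \<in> S \<longleftrightarrow> y \<in> S}"

lemma equiv_two_classes: "equiv UNIV (two_classes S)"
  unfolding two_classes_def by (rule equivI) (auto simp: refl_on_def sym_def trans_def)

theorem theorem4p9:
  "\<exists>E :: nat set \<Rightarrow> (baire \<times> baire) set.
     (\<forall>X. Hyp_nat_set X \<longrightarrow> Hyp_equiv (E X) \<and> eq1 \<le>\<^sub>H E X \<and> E X \<le>\<^sub>H eq2) \<and>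
     (\<forall>X Y. Hyp_nat_set X \<longrightarrow> Hyp_nat_set Y \<longrightarrow> (X \<subseteq> Y \<longleftrightarrow> E X \<le>\<^sub>H E Y))"
proof -
  obtain s where s: "\<And>f j. Hyp_fun f \<Longrightarrow> \<exists>x. (j = 0 \<or> diag s j x) \<and> \<not> in_other s j (f x)"
    using independent_family by blast
  let ?A = "dsum s"
  let ?E = "\<lambda>X. two_classes (?A X)"
  \<comment> \<open>A point common to the complements of all sums, used as a default value
    below.\<close>
  have zero: "(\<lambda>_. 0) \<notin> ?A X" for X unfolding dsum_def by simp
  have 1: "Hyp_equiv (?E X)" if X: "Hyp_nat_set X" for X
  proof -
    have "Hyp_rel (?E X)"
    proof (rule Hyp_relI)
      show "sig11 (\<lambda>e F. (F 0, F 1) \<in> ?E X)"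
        unfolding two_classes_def mem_Collect_eq prod.case iff_conv_conj_imp
        by (intro sig11_conj sig11_imp dsum_mem[OF X])
      show "pi11 (\<lambda>e F. (F 0, F 1) \<in> ?E X)"
        unfolding two_classes_def mem_Collect_eq prod.case iff_conv_conj_imp
        by (intro pi11_conj pi11_imp dsum_mem[OF X])
    qed
    then show ?thesis unfolding Hyp_equiv_def using equiv_two_classes by blast
  qed
  have 2: "eq1 \<le>\<^sub>H ?E X" if X: "Hyp_nat_set X" for X
    unfolding Hyp_le_def
  proof (intro exI conjI allI)
    \<comment> \<open>A constant function, written as a case distinction to fit
      \<open>Hyp_fun_if\<close>.\<close>
    show "Hyp_fun (\<lambda>x. if x \<in> ?A X then (\<lambda>_. 0) else (\<lambda>_. 0))"
      by (intro Hyp_fun_if dsum_mem[OF X] afun_const)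
  qed (simp add: eq1_def two_classes_def)
  have 3: "?E X \<le>\<^sub>H eq2" if X: "Hyp_nat_set X" for X
    unfolding Hyp_le_def
  proof (intro exI conjI allI)
    show "Hyp_fun (\<lambda>x. if x \<in> ?A X then (\<lambda>_. 0) else (\<lambda>_. 1))"
      by (intro Hyp_fun_if dsum_mem[OF X] afun_const)
  qed (simp add: eq2_def two_classes_def)
  have 4: "?E X \<le>\<^sub>H ?E Y" if X: "Hyp_nat_set X" and "X \<subseteq> Y" for X Y
    unfolding Hyp_le_def
  proof (intro exI conjI allI)
    \<comment> \<open>Identity on the smaller sum; everything else goes to a point outside the
      larger one.\<close>
    show "Hyp_fun (\<lambda>x. if x \<in> ?A X then x else (\<lambda>_. 0))"
      by (intro Hyp_fun_if dsum_mem[OF X] afun_const afun_app afun_var)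
    have "?A X \<subseteq> ?A Y" using \<open>X \<subseteq> Y\<close> unfolding dsum_def by blast
    then show "(x, y) \<in> ?E X \<longleftrightarrow> (if x \<in> ?A X then x else (\<lambda>_. 0), if y \<in> ?A X then y else (\<lambda>_. 0)) \<in> ?E Y" for x y
      using zero[of Y] unfolding two_classes_def by auto
  qed
  have 5: "X \<subseteq> Y" if le: "?E X \<le>\<^sub>H ?E Y" for X Y
  proof
    fix n assume n: "n \<in> X"
    obtain f where f: "Hyp_fun f" "\<And>x y. (x, y) \<in> ?E X \<longleftrightarrow> (f x, f y) \<in> ?E Y"
      using le unfolding Hyp_le_def by blast
    \<comment> \<open>Otherwise a constant function would map the whole space into a sum, against
      the case \<open>j = 0\<close>. Hence \<open>f\<close> cannot exchange the two sides.\<close>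
    have "f (\<lambda>_. 0) \<notin> ?A Y"
    proof
      assume "f (\<lambda>_. 0) \<in> ?A Y"
      moreover have "Hyp_fun (\<lambda>x. f (\<lambda>_. 0))"
        by (rule Hyp_fun_comp[OF f(1)]) (rule afun_const)
      ultimately show False using s[of "\<lambda>x. f (\<lambda>_. 0)" 0] unfolding in_other_def dsum_def by auto
    qed
    then have fA: "f x \<in> ?A Y" if "x \<in> ?A X" for x
      using that f(2)[of x "\<lambda>_. 0"] zero[of X] unfolding two_classes_def by auto
    \<comment> \<open>\<open>?h\<close> sends a member of the set with index \<open>Suc n\<close> to
      its copy in the sum.\<close>
    let ?h = "\<lambda>x. case_nat (Suc n) x"
    have "areal (\<lambda>e F. \<lambda>k. if k = 0 then Suc n else F 0 (k - 1))"
      by (intro afun_intros arith_eq)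
    moreover have "case_nat (Suc n) x k = (if k = 0 then Suc n else x (k - 1))" for x :: baire and k
      by (cases k) auto
    ultimately have "Hyp_fun (\<lambda>x. f (?h x))"
      by (intro Hyp_fun_comp[OF f(1)]) simp
    from s[OF this, of "Suc n"] obtain x where x: "diag s (Suc n) x" "\<not> in_other s (Suc n) (f (?h x))"
      by blast
    have "?h x \<in> ?A X" using x(1) n unfolding dsum_def by simp
    then have "f (?h x) \<in> ?A Y" by (rule fA)
    \<comment> \<open>The value lies in the sum for \<open>Y\<close> but in no summand of index
      other than \<open>Suc n\<close>, so its own index is \<open>Suc n\<close>.\<close>
    with x(2) have "f (?h x) 0 = Suc n" "f (?h x) 0 - 1 \<in> Y" unfolding in_other_def dsum_def by auto
    then show "n \<in> Y" by simp
  qed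
  show ?thesis
    by (rule exI[of _ ?E]) (use 1 2 3 4 5 in blast)
qed

end
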